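(* Let $\lambda,\mu>0$. If $\alpha=\beta=1$, then the renewal Mittag-Leffler queue length process ${}_3Q$ with orders $\alpha=\beta=1$ and rates $\lambda,\mu$ is the queue length process of a classical $M/M/1$ queue with inter-arrival rate $\lambda$ and service rate $\mu$ (started empty).
   Context: $E_\alpha(x)=\sum_{k\ge0} x^k/\Gamma(\alpha k+1)$ is the Mittag-Leffler function; $X\sim\mathsf{ML}_\alpha(\lambda)$ means $X\ge0$ and $\mathbb{P}(X>t)=E_\alpha(-\lambda t^\alpha)$ for $t\ge 0$ (so $\mathsf{ML}_1(\lambda)$ is the exponential law of rate $\lambda$). The renewal Mittag-Leffler queue with orders $\alpha,\beta\in(0,1]$ and rates $\lambda,\mu>0$: let $p=\mathbb{P}(X^{(1)}<X^{(2)})$ with $X^{(1)}\sim \mathsf{ML}_\alpha(\lambda)$ and $X^{(2)}\sim\mathsf{ML}_\beta(\mu)$ independent. Let $(\chi_k)_{k\ge1}$ be i.i.d. with $\mathbb{P}(\chi_k=1)=p$, $\mathbb{P}(\chi_k=-1)=1-p$, and $r_0=0$, $r_k=\sum_{j=1}^k\chi_j$. Let $(Y_k)_{k\ge1}$ be i.i.d. with $\mathbb{P}(Y_k>t)=E_\alpha(-\lambda t^\alpha)E_\beta(-\mu t^\beta)$, independent of $(\chi_k)$, $\widetilde N(t)=\max\{k\ge0:\sum_{j=1}^kY_j\le t\}$ and $R(t)=r_{\widetilde N(t)}$. Then ${}_3Q=\Phi(R)$, where $\Phi(f)(t)=f(t)+\sup_{0\le s\le t}\max\{-f(s),0\}$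 is the Skorokhod reflection map. A classical $M/M/1$ queue length process is the continuous-time Markov chain on the non-negative integers started at $0$, with rate $\lambda$ for $i\to i+1$ ($i\ge0$) and rate $\mu$ for $i\to i-1$ ($i\ge1$); equivalently, inter-arrival times are i.i.d. exponential of rate $\lambda$, service times are i.i.d. exponential of rate $\mu$, and the two sequences are independent. *)

theory Defs
  imports "HOL-Probability.Probability"
begin

section \<open>Mittag-Leffler laws\<close>

definition mittag_leffler :: "real \<Rightarrow> real \<Rightarrow> real" where
  "mittag_leffler a x = (\<Sum>k. x ^ k / Gamma (a * real k + 1))"

definition mittag_leffler_distributed :: "'a measure \<Rightarrow> real \<Rightarrow> real \<Rightarrow> ('a \<Rightarrow> real) \<Rightarrow> bool" where
  "mittag_leffler_distributed M a lam X \<longleftrightarrow>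
     X \<in> borel_measurable M \<and>
     (AE \<omega> in M. 0 \<le> X \<omega>) \<and>
     (\<forall>t\<ge>0. measure M {\<omega> \<in> space M. t < X \<omega>} = mittag_leffler a (- lam * t powr a))"

section \<open>The renewal Mittag-Leffler queue\<close>

definition skorokhod_reflection :: "(real \<Rightarrow> real) \<Rightarrow> real \<Rightarrow> real" where
  "skorokhod_reflection f t = f t + (SUP s\<in>{0..t}. max (- f s) 0)"

text \<open>The set under \<open>Max\<close> contains 0 for \<open>t \<ge> 0\<close>. For the waiting times considered below it is almost
  surely finite; on the exceptional null set \<open>Max\<close> has an unspecified value.\<close>

definition renewal_count :: "(nat \<Rightarrow> 'a \<Rightarrow> real) \<Rightarrow> real \<Rightarrow> 'a \<Rightarrow> nat" where
  "renewal_count Y t \<omega> = Max {k. (\<Sum>j=1..k. Y j \<omega>) \<le> t}"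

definition renewal_walk ::
    "(nat \<Rightarrow> 'a \<Rightarrow> real) \<Rightarrow> (nat \<Rightarrow> 'a \<Rightarrow> real) \<Rightarrow> real \<Rightarrow> 'a \<Rightarrow> real" where
  "renewal_walk chi Y t \<omega> = (\<Sum>j=1..renewal_count Y t \<omega>. chi j \<omega>)"

definition renewal_ML_queue_length ::
    "(nat \<Rightarrow> 'a \<Rightarrow> real) \<Rightarrow> (nat \<Rightarrow> 'a \<Rightarrow> real) \<Rightarrow> real \<Rightarrow> 'a \<Rightarrow> real" where
  "renewal_ML_queue_length chi Y t \<omega> = skorokhod_reflection (\<lambda>s. renewal_walk chi Y s \<omega>) t"

text \<open>The variables \<open>X1\<close>, \<open>X2\<close> serve only to determine the up-step probability \<open>p\<close>, so they live on a
  probability space \<open>N\<close> of their own. The sequences \<open>chi\<close> and \<open>Y\<close> are indexed from 1; their value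
  at index 0 plays no role.\<close>

locale renewal_ML_queue =
  M: prob_space M + N: prob_space N
  for M :: "'a measure" and N :: "'b measure" +
  fixes \<alpha> \<beta> lam mu :: real
    and X1 X2 :: "'b \<Rightarrow> real"
    and chi Y :: "nat \<Rightarrow> 'a \<Rightarrow> real"
  assumes orders: "0 < \<alpha>" "\<alpha> \<le> 1" "0 < \<beta>" "\<beta> \<le> 1"
    and rates: "0 < lam" "0 < mu"
    and X1_law: "mittag_leffler_distributed N \<alpha> lam X1"
    and X2_law: "mittag_leffler_distributed N \<beta> mu X2"
    and X1_X2_indep: "N.indep_var borel X1 borel X2"
    and chi_indep: "M.indep_vars (\<lambda>_. borel) chi {1..}"
    and chi_up: "\<And>k. 1 \<le> k \<Longrightarrow>
      M.prob {\<omega> \<in> space M. chi k \<omega> = 1} = N.prob {\<omega> \<in> space N. X1 \<omega> < X2 \<omega>}"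
    and chi_down: "\<And>k. 1 \<le> k \<Longrightarrow>
      M.prob {\<omega> \<in> space M. chi k \<omega> = - 1} = 1 - N.prob {\<omega> \<in> space N. X1 \<omega> < X2 \<omega>}"
    and Y_indep: "M.indep_vars (\<lambda>_. borel) Y {1..}"
    and Y_tail: "\<And>k t. 1 \<le> k \<Longrightarrow> 0 \<le> t \<Longrightarrow>
      M.prob {\<omega> \<in> space M. t < Y k \<omega>} =
        mittag_leffler \<alpha> (- lam * t powr \<alpha>) * mittag_leffler \<beta> (- mu * t powr \<beta>)"
    and chi_Y_indep: "M.indep_var
      (\<Pi>\<^sub>M k\<in>{1..}. borel) (\<lambda>\<omega>. \<lambda>k\<in>{1..}. chi k \<omega>)
      (\<Pi>\<^sub>M k\<in>{1..}. borel) (\<lambda>\<omega>. \<lambda>k\<in>{1..}. Y k \<omega>)"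

section \<open>Continuous-time Markov chains\<close>

text \<open>A stochastic transition semigroup \<open>P t i j\<close> on the state space \<open>S\<close> whose derivative at 0 is the
  matrix \<open>q\<close>, i.e. \<open>P h i j = (if i = j then 1 else 0) + q i j * h + o(h)\<close> as \<open>h\<close> decreases to 0.\<close>

definition transition_semigroup ::
    "'s set \<Rightarrow> ('s \<Rightarrow> 's \<Rightarrow> real) \<Rightarrow> (real \<Rightarrow> 's \<Rightarrow> 's \<Rightarrow> real) \<Rightarrow> bool" where
  "transition_semigroup S q P \<longleftrightarrow>
     (\<forall>t\<ge>0. \<forall>i\<in>S. \<forall>j\<in>S. 0 \<le> P t i j) \<and>
     (\<forall>t\<ge>0. \<forall>i\<in>S. (P t i has_sum 1) S) \<and>
     (\<forall>i\<in>S. \<forall>j\<in>S. P 0 i j = (if i = j then 1 else 0)) \<and>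
     (\<forall>s\<ge>0. \<forall>t\<ge>0. \<forall>i\<in>S. \<forall>j\<in>S. ((\<lambda>k. P s i k * P t k j) has_sum P (s + t) i j) S) \<and>
     (\<forall>i\<in>S. \<forall>j\<in>S. ((\<lambda>t. P t i j) has_real_derivative q i j) (at_right 0))"

text \<open>The chain with rate matrix \<open>q\<close> started at \<open>x0\<close>. The second conjunct of the almost sure statement
  is right-continuity of the path for the discrete topology on \<open>S\<close>.\<close>

definition continuous_time_markov_chain ::
    "'a measure \<Rightarrow> 's set \<Rightarrow> ('s \<Rightarrow> 's \<Rightarrow> real) \<Rightarrow> 's \<Rightarrow> (real \<Rightarrow> 'a \<Rightarrow> 's) \<Rightarrow> bool" where
  "continuous_time_markov_chain M S q x0 X \<longleftrightarrow>
     prob_space M \<and> countable S \<and> x0 \<in> S \<and>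
     (\<forall>t\<ge>0. \<forall>i\<in>S. {\<omega> \<in> space M. X t \<omega> = i} \<in> sets M) \<and>
     (AE \<omega> in M. \<forall>t\<ge>0. X t \<omega> \<in> S \<and> (\<forall>\<^sub>F s in at_right t. X s \<omega> = X t \<omega>)) \<and>
     (AE \<omega> in M. X 0 \<omega> = x0) \<and>
     (\<exists>P. transition_semigroup S q P \<and>
       (\<forall>n (t :: nat \<Rightarrow> real) x.
          0 \<le> t 0 \<longrightarrow> (\<forall>k\<le>n. t k < t (Suc k)) \<longrightarrow> (\<forall>k\<le>Suc n. x k \<in> S) \<longrightarrow>
          measure M {\<omega> \<in> space M. \<forall>k\<le>n. X (t k) \<omega> = x k} > 0 \<longrightarrow>
          cond_prob M (\<lambda>\<omega>. X (t (Suc n)) \<omega> = x (Suc n)) (\<lambda>\<omega>. \<forall>k\<le>n. X (t k) \<omega> = x k)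
            = P (t (Suc n) - t n) (x n) (x (Suc n))))"

text \<open>The state space is \<open>\<nat> :: real set\<close>, since reflected paths are real-valued.\<close>

definition MM1_rate :: "real \<Rightarrow> real \<Rightarrow> real \<Rightarrow> real \<Rightarrow> real" where
  "MM1_rate lam mu i j =
     (if j = i + 1 then lam
      else if 1 \<le> i \<and> j = i - 1 then mu
      else if j = i then - (lam + (if 1 \<le> i then mu else 0))
      else 0)"

definition MM1_queue_length_process ::
    "'a measure \<Rightarrow> real \<Rightarrow> real \<Rightarrow> (real \<Rightarrow> 'a \<Rightarrow> real) \<Rightarrow> bool" where
  "MM1_queue_length_process M lam mu Q \<longleftrightarrow>
     continuous_time_markov_chain M (\<nat> :: real set) (MM1_rate lam mu) 0 Q"

end

theory Submission
  imports Defs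
begin

text \<open>For orders 1 the Mittag-Leffler laws are exponential, so the renewal times \<open>Y\<close> form a Poisson
  process \<open>N\<close> of rate \<open>\<theta> = lam + mu\<close> and \<open>p = lam / \<theta>\<close>. Skorokhod reflection commutes with
  the step-function time change, hence the queue length at time \<open>t\<close> is \<open>W (N t)\<close>, where \<open>W\<close> is the
  random walk reflected at 0, a discrete-time Markov chain with kernel \<open>K\<close> independent of \<open>N\<close>.
  Since \<open>N\<close> has independent Poisson increments, \<open>W (N t)\<close> is a Markov chain with the uniformised
  semigroup \<open>exp (\<theta> t (K - 1))\<close>, whose generator \<open>\<theta> (K - 1)\<close> is the M/M/1 rate matrix: the
  downward jumps suppressed by the reflection at 0 are the self-loop of \<open>K\<close> there.\<close>

section \<open>Uniformised semigroups\<close>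

text \<open>Past queue lengths do not determine past renewal counts, so the independence of walk and
  counts cannot be applied to a queue history directly. The history is therefore refined by the
  counts at the observed times. On each refined history walk and counts factorise, and the resulting
  transition factor depends only on the last queue length, so the refinement can be summed out
  again. Independence of the Poisson increments is reduced to memorylessness of the single gap that
  straddles the present time: the earlier gaps are frozen by Fubini, the later ones are untouched.
  The rate \<open>lam + mu\<close> is that of the minimum of two independent exponentials, and
  \<open>lam / (lam + mu)\<close> is the chance that the arrival clock rings first. No Kolmogorov
  equation is solved: with the semigroup written as a Poisson mixture of kernel powers, its law is
  Poisson convolution and its generator is the first-order coefficient of a power series.\<close>

lemma pmf_has_sum: "(pmf p has_sum 1) UNIV"
proof -
  have *: "Infinite_Set_Sum.abs_summable_on (pmf p) UNIV" by (rule pmf_abs_summable)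
  then have "pmf p summable_on UNIV"
    using abs_summable_equivalent abs_summable_summable by blast
  moreover have "infsum (pmf p) UNIV = 1"
    using infsetsum_infsum[OF *] infsetsum_pmf_eq_1[of p UNIV] by simp
  ultimately show ?thesis by (metis has_sum_infsum)
qed

lemma pmf_bind_has_sum: "((\<lambda>k. pmf p k * pmf (f k) j) has_sum pmf (bind_pmf p f) j) UNIV"
proof -
  have *: "Infinite_Set_Sum.abs_summable_on (\<lambda>k. pmf p k * pmf (f k) j) UNIV"
    by (rule abs_summable_on_comparison_test[OF pmf_abs_summable[of p]])
       (simp add: mult_left_le pmf_le_1)
  then have "(\<lambda>k. pmf p k * pmf (f k) j) summable_on UNIV"
    using abs_summable_equivalent abs_summable_summable by blast
  moreover have "infsum (\<lambda>k. pmf p k * pmf (f k) j) UNIV = pmf (bind_pmf p f) j"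
    using infsetsum_infsum[OF *] by (simp add: pmf_bind pmf_expectation_eq_infsetsum)
  ultimately show ?thesis by (metis has_sum_infsum)
qed

section \<open>Kernel powers and their Poisson mixtures\<close>

primrec kernel_power :: "('s \<Rightarrow> 's pmf) \<Rightarrow> nat \<Rightarrow> 's \<Rightarrow> 's pmf" where
  "kernel_power K 0 i = return_pmf i"
| "kernel_power K (Suc n) i = bind_pmf (kernel_power K n i) K"

lemma kernel_power_add:
  "kernel_power K (m + n) i = bind_pmf (kernel_power K m i) (kernel_power K n)"
  by (induction n) (simp_all add: bind_return_pmf' bind_assoc_pmf)

text \<open>\<open>poisson_pmf\<close> is unspecified at rate 0.\<close>

definition poisson0_pmf :: "real \<Rightarrow> nat pmf" where
  "poisson0_pmf r = (if r = 0 then return_pmf 0 else poisson_pmf r)"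

lemma pmf_poisson0: "0 \<le> r \<Longrightarrow> pmf (poisson0_pmf r) k = r ^ k / fact k * exp (- r)"
  by (auto simp: poisson0_pmf_def power_0_left)

text \<open>Convolution of Poisson laws, which becomes the semigroup law for Poisson mixtures.
  Written out at a point \<open>n\<close>, it is the binomial theorem for
  \<open>(r + s) ^ n\<close>.\<close>

lemma poisson0_add:
  assumes "0 \<le> r" "0 \<le> s"
  shows "bind_pmf (poisson0_pmf r) (\<lambda>a. map_pmf (\<lambda>b. a + b) (poisson0_pmf s)) = poisson0_pmf (r + s)"
proof (rule pmf_eqI)
  fix n
  have inner: "pmf (map_pmf (\<lambda>b. a + b) (poisson0_pmf s)) n =
      (if a \<le> n then s ^ (n - a) / fact (n - a) * exp (- s) else 0)" for a
  proof (cases "a \<le> n")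
    case True
    then have "n = a + (n - a)" by simp
    then have "pmf (map_pmf (\<lambda>b. a + b) (poisson0_pmf s)) n = pmf (poisson0_pmf s) (n - a)"
      by (metis pmf_map_inj' inj_onI add_left_cancel)
    then show ?thesis using True assms by (simp add: pmf_poisson0)
  next
    case False
    then have "n \<notin> set_pmf (map_pmf (\<lambda>b. a + b) (poisson0_pmf s))" by auto
    then show ?thesis using False unfolding set_pmf_iff by simp
  qed
  have "pmf (bind_pmf (poisson0_pmf r) (\<lambda>a. map_pmf (\<lambda>b. a + b) (poisson0_pmf s))) n =
      (\<integral>a. (if a \<le> n then s ^ (n - a) / fact (n - a) * exp (- s) else 0) \<partial>poisson0_pmf r)"
    by (simp add: pmf_bind inner)
  also have "\<dots> = (\<Sum>a\<le>n. s ^ (n - a) / fact (n - a) * exp (- s) * pmf (poisson0_pmf r) a)"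
    by (subst integral_measure_pmf_real[where A = "{..n}"]) (auto split: if_splits)
  also have "\<dots> = exp (- (r + s)) / fact n * (\<Sum>a\<le>n. of_nat (n choose a) * r ^ a * s ^ (n - a))"
    unfolding sum_distrib_left
    by (rule sum.cong) (auto simp: pmf_poisson0 assms binomial_fact exp_diff exp_minus divide_simps)
  also have "\<dots> = pmf (poisson0_pmf (r + s)) n"
    using assms by (simp add: pmf_poisson0 binomial_ring)
  finally show "pmf (bind_pmf (poisson0_pmf r) (\<lambda>a. map_pmf (\<lambda>b. a + b) (poisson0_pmf s))) n =
      pmf (poisson0_pmf (r + s)) n" .
qed

text \<open>The law after a Poisson number of steps. Written as a mixture of \<open>pmf\<close>s,
  the exponential of the generator is stochastic by construction, so positivity and total mass need
  no argument.\<close>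

definition uniformized :: "real \<Rightarrow> ('s \<Rightarrow> 's pmf) \<Rightarrow> real \<Rightarrow> 's \<Rightarrow> 's pmf" where
  "uniformized \<theta> K t i = bind_pmf (poisson0_pmf (\<theta> * t)) (\<lambda>n. kernel_power K n i)"

lemma uniformized_0: "uniformized \<theta> K 0 i = return_pmf i"
  by (simp add: uniformized_def poisson0_pmf_def bind_return_pmf)

lemma uniformized_add:
  assumes "0 \<le> \<theta>" "0 \<le> s" "0 \<le> t"
  shows "uniformized \<theta> K (s + t) i = bind_pmf (uniformized \<theta> K s i) (uniformized \<theta> K t)"
proof -
  have "uniformized \<theta> K (s + t) i = bind_pmf (bind_pmf (poisson0_pmf (\<theta> * s))
      (\<lambda>a. map_pmf (\<lambda>b. a + b) (poisson0_pmf (\<theta> * t)))) (\<lambda>n. kernel_power K n i)"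
    using assms by (simp add: uniformized_def poisson0_add distrib_left)
  also have "\<dots> = bind_pmf (poisson0_pmf (\<theta> * s)) (\<lambda>a. bind_pmf (poisson0_pmf (\<theta> * t))
      (\<lambda>b. bind_pmf (kernel_power K a i) (kernel_power K b)))"
    by (simp add: bind_assoc_pmf bind_map_pmf kernel_power_add)
  \<comment> \<open>The number of steps in the second period is drawn independently of the state
    reached in the first, so the two draws may be exchanged.\<close>
  also have "\<dots> = bind_pmf (uniformized \<theta> K s i) (uniformized \<theta> K t)"
    unfolding uniformized_def
    by (subst bind_commute_pmf[of "poisson0_pmf (\<theta> * t)"]) (simp add: bind_assoc_pmf)
  finally show ?thesis .
qed

lemma nn_integral_poisson0:
  assumes "0 \<le> r"
  shows "(\<integral>\<^sup>+n. f n \<partial>measure_pmf (poisson0_pmf r)) = (\<Sum>n. ennreal (r ^ n / fact n * exp (- r)) * f n)"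
  using assms by (simp add: nn_integral_measure_pmf pmf_poisson0 nn_integral_count_space_nat)

lemma summable_exp_bounded:
  fixes x :: real
  assumes "\<And>n. \<bar>a n\<bar> \<le> 1"
  shows "summable (\<lambda>n. a n * x ^ n / fact n)"
proof (rule summable_comparison_test[OF _ summable_norm_exp[of x]], intro exI allI impI)
  fix n
  have "\<bar>a n\<bar> * (\<bar>x\<bar> ^ n / fact n) \<le> 1 * (\<bar>x\<bar> ^ n / fact n)"
    by (rule mult_right_mono[OF assms]) simp
  then show "norm (a n * x ^ n / fact n) \<le> norm (x ^ n /\<^sub>R fact n)"
    by (simp add: abs_mult power_abs divide_inverse mult.commute mult.left_commute)
qed

text \<open>The powers of \<open>t\<close> are separated from the coefficients so that the series
  can be differentiated term by term at 0.\<close>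

lemma pmf_uniformized:
  assumes "0 \<le> \<theta>" "0 \<le> t"
  shows "pmf (uniformized \<theta> K t i) j =
    exp (- (\<theta> * t)) * (\<Sum>n. (pmf (kernel_power K n i) j * \<theta> ^ n / fact n) * t ^ n)"
proof -
  have 0: "0 \<le> \<theta> * t" using assms by simp
  have sm: "summable (\<lambda>n. pmf (kernel_power K n i) j * (\<theta> * t) ^ n / fact n)"
    by (rule summable_exp_bounded) (simp add: pmf_le_1)
  have "ennreal (pmf (uniformized \<theta> K t i) j) =
      (\<Sum>n. ennreal ((\<theta> * t) ^ n / fact n * exp (- (\<theta> * t))) * ennreal (pmf (kernel_power K n i) j))"
    by (simp add: uniformized_def ennreal_pmf_bind nn_integral_poisson0[OF 0])
  also have "\<dots> = (\<Sum>n. ennreal (exp (- (\<theta> * t)) * (pmf (kernel_power K n i) j * (\<theta> * t) ^ n / fact n)))"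
    using assms by (simp add: ennreal_mult'[symmetric] mult_ac)
  also have "\<dots> = ennreal (\<Sum>n. exp (- (\<theta> * t)) * (pmf (kernel_power K n i) j * (\<theta> * t) ^ n / fact n))"
    using assms sm by (intro suminf_ennreal2 summable_mult) auto
  finally have "pmf (uniformized \<theta> K t i) j =
      (\<Sum>n. exp (- (\<theta> * t)) * (pmf (kernel_power K n i) j * (\<theta> * t) ^ n / fact n))"
    using assms sm by (subst (asm) ennreal_inj) (auto intro!: suminf_nonneg summable_mult simp del: times_divide_eq_right)
  also have "\<dots> = exp (- (\<theta> * t)) * (\<Sum>n. pmf (kernel_power K n i) j * (\<theta> * t) ^ n / fact n)"
    by (rule suminf_mult[OF sm])
  finally show ?thesis by (simp add: power_mult_distrib mult_ac)
qed

text \<open>Only the terms for no step and one step contribute to first order, which gives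
  \<open>c 1 - \<theta> * c 0\<close>; here \<open>c 0\<close> is the identity kernel and
  \<open>c 1\<close> is \<open>\<theta>\<close> times one application of \<open>K\<close>.\<close>

lemma uniformized_deriv_0:
  assumes "0 \<le> \<theta>"
  shows "((\<lambda>t. pmf (uniformized \<theta> K t i) j) has_real_derivative
    \<theta> * (pmf (K i) j - (if i = j then 1 else 0))) (at_right 0)"
proof -
  define c where "c n = pmf (kernel_power K n i) j * \<theta> ^ n / fact n" for n
  have sm: "summable (\<lambda>n. c n * t ^ n)" for t
    using summable_exp_bounded[of "\<lambda>n. pmf (kernel_power K n i) j" "\<theta> * t"]
    by (simp add: c_def pmf_le_1 power_mult_distrib mult_ac)
  have "((\<lambda>t. \<Sum>n. c n * t ^ n) has_real_derivative (\<Sum>n. diffs c n * 0 ^ n)) (at 0)"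
    by (rule termdiffs_strong_converges_everywhere[OF sm])
  then have "((\<lambda>t. \<Sum>n. c n * t ^ n) has_real_derivative c 1) (at 0)"
    by (simp add: diffs_def)
  then have "((\<lambda>t. exp (- (\<theta> * t)) * (\<Sum>n. c n * t ^ n)) has_real_derivative c 1 - \<theta> * c 0) (at 0)"
    by (auto intro!: derivative_eq_intros)
  then have "((\<lambda>t. exp (- (\<theta> * t)) * (\<Sum>n. c n * t ^ n)) has_real_derivative c 1 - \<theta> * c 0) (at_right 0)"
    by (rule has_field_derivative_at_within)
  also have "c 1 - \<theta> * c 0 = \<theta> * (pmf (K i) j - (if i = j then 1 else 0))"
    by (auto simp: c_def bind_return_pmf algebra_simps)
  \<comment> \<open>The series represents the mixture only for \<open>0 \<le> t\<close>, so the two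
    functions are compared at 0 and to the right of it.\<close>
  finally show ?thesis
    by (rule has_field_derivative_cong_eventually[THEN iffD1, rotated 2])
       (auto simp: pmf_uniformized[OF assms] c_def eventually_at_right_less
          intro: eventually_mono[OF eventually_at_right_less])
qed

lemma transition_semigroup_uniformized:
  assumes "0 \<le> \<theta>"
  shows "transition_semigroup UNIV (\<lambda>i j. \<theta> * (pmf (K i) j - (if i = j then 1 else 0)))
    (\<lambda>t i j. pmf (uniformized \<theta> K t i) j)"
  unfolding transition_semigroup_def
  using assms
  by (auto simp: pmf_has_sum uniformized_0 uniformized_add pmf_bind_has_sum uniformized_deriv_0)

text \<open>The walk lives on \<open>nat\<close>, whereas the target chain has the reals in
  \<open>\<nat>\<close> as states; a bijection carries the semigroup across.\<close>

lemma transition_semigroup_reindex: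
  assumes g: "bij_betw g S T" and P: "transition_semigroup T q P"
  shows "transition_semigroup S (\<lambda>i j. q (g i) (g j)) (\<lambda>t i j. P t (g i) (g j))"
proof -
  have S: "g i \<in> T" if "i \<in> S" for i using g that by (auto simp: bij_betw_def)
  have eq: "g i = g j \<longleftrightarrow> i = j" if "i \<in> S" "j \<in> S" for i j
    using g that by (auto simp: bij_betw_def inj_on_def)
  have hs: "((\<lambda>k. f (g k)) has_sum x) S \<longleftrightarrow> (f has_sum x) T" for f :: "_ \<Rightarrow> real" and x
    by (rule has_sum_reindex_bij_betw[OF g])
  show ?thesis
    using P unfolding transition_semigroup_def
    by (auto simp: S eq hs[of "P _ (g _)"] hs[of "\<lambda>k. P _ (g _) k * P _ k (g _)"])
qed

section \<open>Paths of the reflected renewal walk\<close>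

text \<open>Positive gaps make the partial sums strictly increasing, and unboundedness makes the set
  under \<open>Max\<close> finite. It is then an initial segment of the indices, determined by where
  \<open>t\<close> falls between two consecutive epochs.\<close>

lemma renewal_count_eq_iff:
  fixes y :: "nat \<Rightarrow> 'a \<Rightarrow> real"
  assumes pos: "\<forall>k\<ge>1. 0 < y k \<omega>"
    and unbounded: "\<forall>b. \<exists>k. b < (\<Sum>j=1..k. y j \<omega>)"
    and t: "0 \<le> t"
  shows "renewal_count y t \<omega> = n \<longleftrightarrow> (\<Sum>j=1..n. y j \<omega>) \<le> t \<and> t < (\<Sum>j=1..Suc n. y j \<omega>)"
proof -
  let ?S = "\<lambda>k. \<Sum>j=1..k. y j \<omega>" and ?A = "{k. (\<Sum>j=1..k. y j \<omega>) \<le> t}"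
  have "strict_mono ?S" by (rule strict_monoI_Suc) (use pos in simp)
  note less = strict_mono_less[OF this]
  obtain b where "t < ?S b" using unbounded by blast
  have "?A \<subseteq> {..b}"
  proof
    fix k assume "k \<in> ?A"
    then have "?S k < ?S b" using \<open>t < ?S b\<close> by (simp only: mem_Collect_eq)
    then show "k \<in> {..b}" unfolding less by simp
  qed
  then have fin: "finite ?A" by (rule finite_subset) simp
  have ne: "?A \<noteq> {}" using t by (auto intro!: exI[of _ 0])
  show ?thesis unfolding renewal_count_def
  proof
    assume n: "Max ?A = n"
    then have "n \<in> ?A" using Max_in[OF fin ne] by simp
    moreover have "Suc n \<notin> ?A" using Max_ge[OF fin, of "Suc n"] n by auto
    ultimately show "?S n \<le> t \<and> t < ?S (Suc n)" by (simp del: sum.cl_ivl_Suc)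
  next
    assume *: "?S n \<le> t \<and> t < ?S (Suc n)"
    show "Max ?A = n"
    proof (rule Max_eqI[OF fin])
      show "k \<le> n" if "k \<in> ?A" for k
        using that * less[of k "Suc n"] by (simp del: sum.cl_ivl_Suc)
    qed (use * in simp)
  qed
qed

text \<open>Lindley's recursion. Truncated subtraction \<open>0 - 1 = 0\<close> is the departure
  suppressed at an empty queue. Every step other than \<open>1\<close> counts as downward, so the
  walk is defined on exceptional paths too.\<close>

primrec reflected_walk :: "(nat \<Rightarrow> real) \<Rightarrow> nat \<Rightarrow> nat" where
  "reflected_walk c 0 = 0"
| "reflected_walk c (Suc n) =
    (if c (Suc n) = 1 then Suc (reflected_walk c n) else reflected_walk c n - 1)"

text \<open>The discrete Skorokhod formula. Truncating at 0 in one step of the recursion amounts to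
  admitting one more index to the running maximum.\<close>

lemma reflected_walk_eq_Max:
  assumes "\<forall>k\<ge>1. c k = 1 \<or> c k = - 1"
  shows "real (reflected_walk c n) =
    (\<Sum>j=1..n. c j) + (MAX k\<in>{..n}. max (- (\<Sum>j=1..k. c j)) 0)"
proof (induction n)
  case (Suc n)
  let ?h = "\<lambda>k. max (- (\<Sum>j=1..k. c j)) 0"
  have "?h 0 \<le> (MAX k\<in>{..n}. ?h k)" by (intro Max_ge imageI) simp_all
  then have nonneg: "0 \<le> (MAX k\<in>{..n}. ?h k)" by simp
  \<comment> \<open>Here \<open>r\<close> is the free walk, \<open>b\<close> its running maximum and
    \<open>s\<close> the new step. Both sides are \<open>max b (- (r + s))\<close> shifted by
    \<open>r + s\<close>; the extra 0 on the right is absorbed by \<open>0 \<le> b\<close>.\<close>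
  have arith: "max (r + b + s) 0 = (r + s) + max (max (- (r + s)) 0) b" if "0 \<le> b" for r s b :: real
    using that by (simp add: max_def)
  have "real (reflected_walk c (Suc n)) = max (real (reflected_walk c n) + c (Suc n)) 0"
    by (cases "reflected_walk c n") (use assms[rule_format, of "Suc n"] in auto)
  also have "\<dots> = (\<Sum>j=1..n. c j) + c (Suc n) +
      max (max (- ((\<Sum>j=1..n. c j) + c (Suc n))) 0) (MAX k\<in>{..n}. ?h k)"
    unfolding Suc by (rule arith[OF nonneg])
  also have "(\<Sum>j=1..n. c j) + c (Suc n) = (\<Sum>j=1..Suc n. c j)" by simp
  also have "max (?h (Suc n)) (MAX k\<in>{..n}. ?h k) = (MAX k\<in>{..Suc n}. ?h k)"
    unfolding atMost_Suc image_insert by (rule Max_insert[symmetric]) auto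
  finally show ?case .
qed simp

text \<open>Up to time \<open>t\<close> the count visits every index from 0 to its current value and
  no other. The supremum over an interval of times is thus a maximum over finitely many indices, to
  which the discrete formula applies.\<close>

lemma renewal_ML_queue_length_eq_reflected_walk:
  fixes y chi :: "nat \<Rightarrow> 'a \<Rightarrow> real"
  assumes pos: "\<forall>k\<ge>1. 0 < y k \<omega>"
    and unbounded: "\<forall>b. \<exists>k. b < (\<Sum>j=1..k. y j \<omega>)"
    and steps: "\<forall>k\<ge>1. chi k \<omega> = 1 \<or> chi k \<omega> = - 1"
    and t: "0 \<le> t"
  shows "renewal_ML_queue_length chi y t \<omega> =
    real (reflected_walk (\<lambda>k. chi k \<omega>) (renewal_count y t \<omega>))"
proof -
  let ?S = "\<lambda>k. \<Sum>j=1..k. y j \<omega>" and ?N = "\<lambda>s. renewal_count y s \<omega>"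
    and ?h = "\<lambda>k. max (- (\<Sum>j=1..k. chi j \<omega>)) 0"
  have smono: "strict_mono ?S" by (rule strict_monoI_Suc) (use pos in simp)
  note count = renewal_count_eq_iff[where y = y, OF pos unbounded]
  have image: "?N ` {0..t} = {..?N t}"
  proof safe
    fix s assume s: "s \<in> {0..t}"
    have "?S (?N s) \<le> s" using count[of s "?N s"] s by simp
    also have "s \<le> t" using s by simp
    also have "t < ?S (Suc (?N t))" using count[of t "?N t"] t by simp
    finally show "?N s \<le> ?N t" by (simp add: strict_mono_less[OF smono] del: sum.cl_ivl_Suc One_nat_def)
  next
    \<comment> \<open>The witness is the \<open>k\<close>-th epoch itself: a renewal at time
      \<open>s\<close> is already counted at \<open>s\<close>.\<close>
    fix k assume k: "k \<le> ?N t"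
    have "0 \<le> ?S k" using pos by (intro sum_nonneg) (simp add: less_imp_le)
    moreover have "?S k \<le> t"
    proof (rule order_trans)
      show "?S k \<le> ?S (?N t)" using k by (simp only: strict_mono_less_eq[OF smono])
      show "?S (?N t) \<le> t" using count[of t "?N t"] t by simp
    qed
    moreover have "?N (?S k) = k"
      using count[of "?S k" k] \<open>0 \<le> ?S k\<close> pos by simp
    ultimately show "k \<in> ?N ` {0..t}" by (intro image_eqI[of _ _ "?S k"]) simp_all
  qed
  have "(\<lambda>s. max (- renewal_walk chi y s \<omega>) 0) ` {0..t} = ?h ` (?N ` {0..t})"
    by (simp add: renewal_walk_def image_image)
  then have "(\<lambda>s. max (- renewal_walk chi y s \<omega>) 0) ` {0..t} = ?h ` {..?N t}"
    unfolding image .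
  then have "(SUP s\<in>{0..t}. max (- renewal_walk chi y s \<omega>) 0) = (MAX k\<in>{..?N t}. ?h k)"
    by (simp add: cSup_eq_Max)
  then show ?thesis
    using reflected_walk_eq_Max[where c = "\<lambda>k. chi k \<omega>", OF steps]
    by (simp add: renewal_ML_queue_length_def skorokhod_reflection_def renewal_walk_def)
qed

text \<open>The count is constant on each gap between epochs, and these gaps are closed on the left
  and open on the right.\<close>

lemma renewal_count_right_constant:
  fixes y :: "nat \<Rightarrow> 'a \<Rightarrow> real"
  assumes pos: "\<forall>k\<ge>1. 0 < y k \<omega>"
    and unbounded: "\<forall>b. \<exists>k. b < (\<Sum>j=1..k. y j \<omega>)"
    and t: "0 \<le> t"
  shows "\<forall>\<^sub>F s in at_right t. renewal_count y s \<omega> = renewal_count y t \<omega>"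
proof -
  note count = renewal_count_eq_iff[where y = y, OF pos unbounded]
  let ?n = "renewal_count y t \<omega>"
  have *: "(\<Sum>j=1..?n. y j \<omega>) \<le> t \<and> t < (\<Sum>j=1..Suc ?n. y j \<omega>)"
    using count[OF t, of ?n] by simp
  then have "\<forall>\<^sub>F s in at_right t. s \<in> {t<..<\<Sum>j=1..Suc ?n. y j \<omega>}"
    by (intro eventually_at_right_real) simp
  then show ?thesis
  proof (rule eventually_mono)
    fix s assume s: "s \<in> {t<..<\<Sum>j=1..Suc ?n. y j \<omega>}"
    then show "renewal_count y s \<omega> = ?n"
      using * t by (subst count) (auto simp del: sum.cl_ivl_Suc)
  qed
qed

section \<open>Measurability\<close>

text \<open>The real \<open>Sup\<close> is defined as the \<open>LEAST\<close> upper bound, so it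
  depends on the set of upper bounds alone. No boundedness is required: unspecified values agree as
  well.\<close>

lemma Sup_real_eqI:
  fixes A B :: "real set"
  assumes "\<And>z. (\<forall>x\<in>A. x \<le> z) \<longleftrightarrow> (\<forall>x\<in>B. x \<le> z)"
  shows "Sup A = Sup B"
  unfolding Sup_real_def using assms by simp

text \<open>Where the family is unbounded there is no upper bound, and \<open>Sup\<close> equals the
  one fixed value \<open>LEAST z. False\<close>. The bounded part is a measurable set, on which the
  usual result applies.\<close>

lemma borel_measurable_SUP_real:
  fixes h :: "nat \<Rightarrow> 'a \<Rightarrow> real"
  assumes [measurable]: "\<And>k. h k \<in> borel_measurable M"
  shows "(\<lambda>\<omega>. SUP k. h k \<omega>) \<in> borel_measurable M"
proof -
  let ?bdd = "\<lambda>\<omega>. \<exists>n::nat. \<forall>k. h k \<omega> \<le> real n"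
  have eq: "(SUP k. h k \<omega>) =
      (if ?bdd \<omega> then SUP k. (if ?bdd \<omega> then h k \<omega> else 0) else (LEAST z::real. False))" for \<omega>
  proof (cases "?bdd \<omega>")
    case False
    have "(\<forall>k. h k \<omega> \<le> z) = False" for z
      using False real_arch_simple[of z] by (meson order_trans)
    then show ?thesis using False by (simp add: Sup_real_def del: not_all)
  qed simp
  have "(\<lambda>\<omega>. SUP k. (if ?bdd \<omega> then h k \<omega> else 0)) \<in> borel_measurable M"
  proof (rule borel_measurable_cSUP)
    show "bdd_above (range (\<lambda>k. if ?bdd \<omega> then h k \<omega> else 0))" for \<omega>
      by (cases "?bdd \<omega>") (auto simp: bdd_above_def)
  qed auto
  then show ?thesis unfolding eq by measurable
qed

text \<open>\<open>Max\<close> returns the same unspecified value on all infinite sets, so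
  \<open>Max UNIV\<close> can name it.\<close>

lemma renewal_count_infinite:
  "infinite {k. (\<Sum>j=1..k. y j \<omega>) \<le> t} \<Longrightarrow> renewal_count y t \<omega> = Max (UNIV :: nat set)"
  unfolding renewal_count_def by (simp add: Max.infinite)

lemma renewal_count_finite:
  assumes "finite {k. (\<Sum>j=1..k. y j \<omega>) \<le> t}" "0 \<le> t"
  shows "renewal_count y t \<omega> = n \<longleftrightarrow>
    (\<Sum>j=1..n. y j \<omega>) \<le> t \<and> (\<forall>k>n. t < (\<Sum>j=1..k. y j \<omega>))"
proof -
  let ?A = "{k. (\<Sum>j=1..k. y j \<omega>) \<le> t}"
  have "?A \<noteq> {}" using assms(2) by (auto intro!: exI[of _ 0])
  then have "Max ?A = n \<longleftrightarrow> n \<in> ?A \<and> (\<forall>k\<in>?A. k \<le> n)"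
    by (rule Max_eq_iff[OF assms(1)])
  also have "(\<forall>k\<in>?A. k \<le> n) \<longleftrightarrow> (\<forall>k>n. t < (\<Sum>j=1..k. y j \<omega>))"
    unfolding Ball_def mem_Collect_eq by (meson not_le)
  finally show ?thesis unfolding renewal_count_def mem_Collect_eq .
qed

text \<open>The measure need not be complete, so measurability has to be checked on the exceptional null set
  as well, where \<open>Max\<close> and \<open>Sup\<close> are unspecified.\<close>

lemma renewal_count_eq_iff_countable:
  assumes "0 \<le> t"
  shows "renewal_count y t \<omega> = n \<longleftrightarrow>
    (if \<forall>m. \<exists>k>m. (\<Sum>j=1..k. y j \<omega>) \<le> t then n = Max (UNIV :: nat set)
     else (\<Sum>j=1..n. y j \<omega>) \<le> t \<and> (\<forall>k>n. t < (\<Sum>j=1..k. y j \<omega>)))"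
  using renewal_count_finite[of y \<omega> t n] renewal_count_infinite[of y \<omega> t] assms
    infinite_nat_iff_unbounded[of "{k. (\<Sum>j=1..k. y j \<omega>) \<le> t}"]
  by (simp only: mem_Collect_eq split: if_split) metis

text \<open>Removes the uncountable quantifier over times. A regular visit to \<open>n\<close> can
  be tested at the earliest candidate time, \<open>max 0\<close> of the partial sum, since partial
  sums may be negative on exceptional paths. The unspecified value can be tested at
  \<open>t\<close>, because infinitely many partial sums below \<open>s\<close> remain below every
  later time.\<close>

lemma renewal_count_hits_iff:
  assumes t: "0 \<le> t"
  shows "(\<exists>s\<in>{0..t}. renewal_count y s \<omega> = n) \<longleftrightarrow>
    (\<Sum>j=1..n. y j \<omega>) \<le> t \<and> (\<forall>k>n. max 0 (\<Sum>j=1..n. y j \<omega>) < (\<Sum>j=1..k. y j \<omega>)) \<or>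
    n = Max (UNIV :: nat set) \<and> (\<forall>m. \<exists>k>m. (\<Sum>j=1..k. y j \<omega>) \<le> t)"
    (is "?L \<longleftrightarrow> ?R1 \<or> ?R2")
proof
  let ?S = "\<lambda>k. \<Sum>j=1..k. y j \<omega>"
  assume ?L
  then obtain s where s: "0 \<le> s" "s \<le> t" "renewal_count y s \<omega> = n" by auto
  show "?R1 \<or> ?R2"
  proof (cases "\<forall>m. \<exists>k>m. ?S k \<le> s")
    case True
    then have "n = Max (UNIV :: nat set)"
      using s renewal_count_eq_iff_countable[OF s(1), of y \<omega> n] by simp
    moreover have "\<exists>k>m. ?S k \<le> t" for m
      using True[rule_format, of m] s(2) by (blast intro: order_trans)
    ultimately have ?R2 by blast
    then show ?thesis ..
  next
    case False
    then have "?S n \<le> s \<and> (\<forall>k>n. s < ?S k)"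
      using renewal_count_eq_iff_countable[OF s(1), of y \<omega> n, THEN iffD1, OF s(3)]
      unfolding if_not_P[OF False] by iprover
    moreover from this s have "max 0 (?S n) \<le> s" "?S n \<le> t" by linarith+
    ultimately have ?R1 by (blast intro: le_less_trans)
    then show ?thesis ..
  qed
next
  let ?S = "\<lambda>k. \<Sum>j=1..k. y j \<omega>"
  assume "?R1 \<or> ?R2"
  then show ?L
  proof
    assume *: ?R1
    have "\<not> (\<forall>m. \<exists>k>m. ?S k \<le> max 0 (?S n))" using * not_le by blast
    moreover have "?S n \<le> max 0 (?S n) \<and> (\<forall>k>n. max 0 (?S n) < ?S k)" using * by simp
    ultimately have "renewal_count y (max 0 (?S n)) \<omega> = n"
      by (simp only: renewal_count_eq_iff_countable[OF max.cobounded1] if_False simp_thms) blast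
    moreover have "max 0 (?S n) \<in> {0..t}" using * t by simp
    ultimately show ?L by blast
  next
    assume ?R2
    then have "renewal_count y t \<omega> = n" by (simp only: renewal_count_eq_iff_countable[OF t] if_True simp_thms)
    then show ?L using t by auto
  qed
qed

lemma measurable_renewal_count [measurable]:
  assumes [measurable]: "\<And>k. 1 \<le> k \<Longrightarrow> y k \<in> borel_measurable M"
    and t: "0 \<le> t"
  shows "renewal_count y t \<in> M \<rightarrow>\<^sub>M count_space UNIV"
proof (rule measurable_count_space_eq_countable[THEN iffD2, OF countableI_type], safe)
  fix n
  have [measurable]: "(\<lambda>\<omega>. \<Sum>j=1..k. y j \<omega>) \<in> borel_measurable M" for k
    by (rule borel_measurable_sum) simp
  have "renewal_count y t -` {n} \<inter> space M = {\<omega>\<in>space M. renewal_count y t \<omega> = n}" by auto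
  also have "\<dots> \<in> sets M"
    unfolding renewal_count_eq_iff_countable[OF t] by measurable
  finally show "renewal_count y t -` {n} \<inter> space M \<in> sets M" .
qed auto

text \<open>The supremum over times is rewritten as a supremum over the countably many values that
  the count may take, with an indicator of whether a value is taken by time
  \<open>t\<close>.\<close>

lemma measurable_renewal_ML_queue_length:
  assumes chi [measurable]: "\<And>k. 1 \<le> k \<Longrightarrow> chi k \<in> borel_measurable M"
    and y [measurable]: "\<And>k. 1 \<le> k \<Longrightarrow> y k \<in> borel_measurable M"
    and t: "0 \<le> t"
  shows "renewal_ML_queue_length chi y t \<in> borel_measurable M"
proof -
  have [measurable]: "(\<lambda>\<omega>. \<Sum>j=1..k. y j \<omega>) \<in> borel_measurable M"
    "(\<lambda>\<omega>. \<Sum>j=1..k. chi j \<omega>) \<in> borel_measurable M" for k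
    by (rule borel_measurable_sum; simp)+
  note [measurable] = measurable_renewal_count[OF y t]
  have walk: "renewal_walk chi y t \<in> borel_measurable M"
    unfolding renewal_walk_def by measurable
  let ?r = "\<lambda>k \<omega>. max (- (\<Sum>j=1..k. chi j \<omega>)) 0"
  \<comment> \<open>The default 0 for indices not visited is harmless: every visited term is at
    least 0, and at least one index is visited, so the upper bounds stay the same.\<close>
  define h where "h k \<omega> = (if \<exists>s\<in>{0..t}. renewal_count y s \<omega> = k then ?r k \<omega> else 0)" for k \<omega>
  have "h k \<in> borel_measurable M" for k
    unfolding h_def renewal_count_hits_iff[OF t] by measurable
  then have "(\<lambda>\<omega>. SUP k. h k \<omega>) \<in> borel_measurable M" by (rule borel_measurable_SUP_real)
  moreover have "(SUP s\<in>{0..t}. max (- renewal_walk chi y s \<omega>) 0) = (SUP k. h k \<omega>)" for \<omega>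
  proof (rule Sup_real_eqI)
    fix z
    let ?f = "\<lambda>s. ?r (renewal_count y s \<omega>) \<omega>"
    have "(\<forall>s\<in>{0..t}. ?f s \<le> z) \<longleftrightarrow> (\<forall>k. h k \<omega> \<le> z)"
    proof
      assume *: "\<forall>s\<in>{0..t}. ?f s \<le> z"
      moreover have "0 \<in> {0..t}" using t by simp
      ultimately have "?f 0 \<le> z" by blast
      then have "0 \<le> z" by simp
      then show "\<forall>k. h k \<omega> \<le> z" using * by (auto simp: h_def)
    next
      assume *: "\<forall>k. h k \<omega> \<le> z"
      show "\<forall>s\<in>{0..t}. ?f s \<le> z"
      proof
        fix s assume "s \<in> {0..t}"
        then have "?f s = h (renewal_count y s \<omega>) \<omega>" unfolding h_def by (subst if_P) auto
        then show "?f s \<le> z" using * by simp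
      qed
    qed
    then show "(\<forall>x\<in>(\<lambda>s. max (- renewal_walk chi y s \<omega>) 0) ` {0..t}. x \<le> z) \<longleftrightarrow>
        (\<forall>x\<in>range (\<lambda>k. h k \<omega>). x \<le> z)"
      by (simp add: renewal_walk_def del: max.bounded_iff)
  qed
  ultimately show ?thesis
    using walk unfolding renewal_ML_queue_length_def skorokhod_reflection_def by simp
qed

section \<open>Independence and memorylessness\<close>

text \<open>Fubini for the product law of an independent pair: \<open>U\<close> is frozen while
  \<open>V\<close> is sampled afresh.\<close>

lemma (in prob_space) emeasure_indep_var_Pair:
  assumes ind: "indep_var S U T V" and A [measurable]: "A \<in> sets (S \<Otimes>\<^sub>M T)"
  shows "emeasure M {\<omega>\<in>space M. (U \<omega>, V \<omega>) \<in> A} =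
    (\<integral>\<^sup>+\<omega>. emeasure M {\<omega>'\<in>space M. (U \<omega>, V \<omega>') \<in> A} \<partial>M)"
proof -
  have U [measurable]: "U \<in> M \<rightarrow>\<^sub>M S" and V [measurable]: "V \<in> M \<rightarrow>\<^sub>M T"
    using ind by (auto dest: indep_var_rv1 indep_var_rv2)
  interpret V: prob_space "distr M T V" by (rule prob_space_distr) fact
  have "emeasure M {\<omega>\<in>space M. (U \<omega>, V \<omega>) \<in> A} = emeasure (distr M (S \<Otimes>\<^sub>M T) (\<lambda>\<omega>. (U \<omega>, V \<omega>))) A"
    by (subst emeasure_distr) (auto intro!: arg_cong[where f = "emeasure M"])
  also have "\<dots> = emeasure (distr M S U \<Otimes>\<^sub>M distr M T V) A"
    using ind by (simp add: indep_var_distribution_eq)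
  also have "\<dots> = (\<integral>\<^sup>+x. emeasure (distr M T V) (Pair x -` A) \<partial>distr M S U)"
    by (rule V.emeasure_pair_measure_alt) simp
  also have "\<dots> = (\<integral>\<^sup>+\<omega>. emeasure (distr M T V) (Pair (U \<omega>) -` A) \<partial>M)"
    by (rule nn_integral_distr) (auto intro!: V.measurable_emeasure_Pair)
  also have "\<dots> = (\<integral>\<^sup>+\<omega>. emeasure M {\<omega>'\<in>space M. (U \<omega>, V \<omega>') \<in> A} \<partial>M)"
    by (intro nn_integral_cong, subst emeasure_distr)
       (auto intro!: arg_cong[where f = "emeasure M"] sets_Pair1)
  finally show ?thesis .
qed

lemma (in prob_space) prob_indep_var_conj:
  assumes "indep_var S U T V" "A \<in> sets S" "B \<in> sets T"
  shows "prob {\<omega>\<in>space M. U \<omega> \<in> A \<and> V \<omega> \<in> B} =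
    prob {\<omega>\<in>space M. U \<omega> \<in> A} * prob {\<omega>\<in>space M. V \<omega> \<in> B}"
proof -
  have "(\<lambda>\<omega>. (U \<omega>, V \<omega>)) -` (A \<times> B) \<inter> space M = {\<omega>\<in>space M. U \<omega> \<in> A \<and> V \<omega> \<in> B}"
    "U -` A \<inter> space M = {\<omega>\<in>space M. U \<omega> \<in> A}" "V -` B \<inter> space M = {\<omega>\<in>space M. V \<omega> \<in> B}"
    by auto
  with indep_varD[OF assms] show ?thesis by simp
qed

lemma (in prob_space) prob_eq_suminf_values:
  fixes J :: "'a \<Rightarrow> nat"
  assumes [measurable]: "Measurable.pred M P" "J \<in> M \<rightarrow>\<^sub>M count_space UNIV"
  shows "(\<lambda>d. prob {\<omega>\<in>space M. P \<omega> \<and> J \<omega> = d}) sums prob {\<omega>\<in>space M. P \<omega>}"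
proof -
  have "(\<lambda>d. prob {\<omega>\<in>space M. P \<omega> \<and> J \<omega> = d}) sums
      prob (\<Union>d. {\<omega>\<in>space M. P \<omega> \<and> J \<omega> = d})"
    by (rule finite_measure_UNION) (auto simp: disjoint_family_on_def)
  also have "(\<Union>d. {\<omega>\<in>space M. P \<omega> \<and> J \<omega> = d}) = {\<omega>\<in>space M. P \<omega>}" by auto
  finally show ?thesis .
qed

text \<open>Sums out an auxiliary history \<open>L\<close>. This works because the factor
  \<open>c\<close> is the same for every value of \<open>L\<close>; the product form avoids division
  by probabilities that may vanish.\<close>

lemma (in prob_space) prob_conj_eq_mult_countable:
  fixes L :: "'a \<Rightarrow> 'l::countable"
  assumes [measurable]: "Measurable.pred M P" "Measurable.pred M Q" "L \<in> M \<rightarrow>\<^sub>M count_space UNIV"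
    and eq: "\<And>l. prob {\<omega>\<in>space M. (P \<omega> \<and> L \<omega> = l) \<and> Q \<omega>} = prob {\<omega>\<in>space M. P \<omega> \<and> L \<omega> = l} * c"
  shows "prob {\<omega>\<in>space M. P \<omega> \<and> Q \<omega>} = prob {\<omega>\<in>space M. P \<omega>} * c"
proof -
  define J where "J = to_nat \<circ> L"
  have [measurable]: "J \<in> M \<rightarrow>\<^sub>M count_space UNIV" unfolding J_def by measurable
  have "prob {\<omega>\<in>space M. (P \<omega> \<and> Q \<omega>) \<and> J \<omega> = d} = prob {\<omega>\<in>space M. P \<omega> \<and> J \<omega> = d} * c" for d
  proof (cases "d \<in> range (to_nat :: 'l \<Rightarrow> nat)")
    case True
    then obtain l where "d = to_nat (l :: 'l)" by auto
    then show ?thesis using eq[of l] by (simp add: J_def conj_ac)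
  next
    case False
    then have "J \<omega> = d \<longleftrightarrow> False" for \<omega> by (auto simp: J_def)
    then show ?thesis by simp
  qed
  then have "(\<lambda>d. prob {\<omega>\<in>space M. P \<omega> \<and> J \<omega> = d} * c) sums prob {\<omega>\<in>space M. P \<omega> \<and> Q \<omega>}"
    using prob_eq_suminf_values[of "\<lambda>\<omega>. P \<omega> \<and> Q \<omega>" J] by simp
  moreover have "(\<lambda>d. prob {\<omega>\<in>space M. P \<omega> \<and> J \<omega> = d} * c) sums (prob {\<omega>\<in>space M. P \<omega>} * c)"
    by (intro sums_mult2 prob_eq_suminf_values) measurable
  ultimately show ?thesis by (rule sums_unique2)
qed

text \<open>Memorylessness jointly with independent data: beyond \<open>u\<close>, the overshoot and
  \<open>V\<close> have their original joint law, weighted by the chance of exceeding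
  \<open>u\<close>. The proof translates the density integral by \<open>u\<close>. The map
  \<open>g\<close> lets \<open>U\<close> be a restricted family of which one coordinate is
  exponential.\<close>

lemma (in prob_space) exponential_memoryless_joint:
  assumes l: "0 < l" and D: "distributed M lborel (\<lambda>\<omega>. g (U \<omega>)) (exponential_density l)"
    and ind: "indep_var S U T V" and g [measurable]: "g \<in> borel_measurable S"
    and A [measurable]: "A \<in> sets (borel \<Otimes>\<^sub>M T)" and u: "0 \<le> u"
  shows "emeasure M {\<omega>\<in>space M. u < g (U \<omega>) \<and> (g (U \<omega>) - u, V \<omega>) \<in> A} =
    ennreal (exp (- l * u)) * emeasure M {\<omega>\<in>space M. (g (U \<omega>), V \<omega>) \<in> A}"
proof -
  have V [measurable]: "V \<in> M \<rightarrow>\<^sub>M T" and U [measurable]: "U \<in> M \<rightarrow>\<^sub>M S"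
    using ind by (auto dest: indep_var_rv1 indep_var_rv2)
  define G where "G x = emeasure (distr M T V) (Pair x -` A)" for x
  interpret V: prob_space "distr M T V" by (rule prob_space_distr) fact
  have [measurable]: "G \<in> borel_measurable borel"
    unfolding G_def by (rule V.measurable_emeasure_Pair) simp
  have G: "emeasure M {\<omega>'\<in>space M. (x, V \<omega>') \<in> A} = G x" for x
    unfolding G_def by (subst emeasure_distr) (auto intro!: arg_cong[where f = "emeasure M"] sets_Pair1)
  have gt: "emeasure M {\<omega>\<in>space M. u < g (U \<omega>) \<and> (g (U \<omega>) - u, V \<omega>) \<in> A} =
      (\<integral>\<^sup>+x. ennreal (exponential_density l x) * (indicator {u<..} x * G (x - u)) \<partial>lborel)"
  proof -
    have "emeasure M {\<omega>\<in>space M. u < g (U \<omega>) \<and> (g (U \<omega>) - u, V \<omega>) \<in> A} =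
        emeasure M {\<omega>\<in>space M. (U \<omega>, V \<omega>) \<in> {z\<in>space (S \<Otimes>\<^sub>M T). u < g (fst z) \<and> (g (fst z) - u, snd z) \<in> A}}"
      by (intro arg_cong[where f = "emeasure M"])
         (use measurable_space[OF U] measurable_space[OF V] in \<open>auto simp: space_pair_measure\<close>)
    also have "\<dots> = (\<integral>\<^sup>+\<omega>. emeasure M {\<omega>'\<in>space M. (U \<omega>, V \<omega>') \<in>
        {z\<in>space (S \<Otimes>\<^sub>M T). u < g (fst z) \<and> (g (fst z) - u, snd z) \<in> A}} \<partial>M)"
      by (rule emeasure_indep_var_Pair[OF ind]) measurable
    also have "\<dots> = (\<integral>\<^sup>+\<omega>. indicator {u<..} (g (U \<omega>)) * G (g (U \<omega>) - u) \<partial>M)"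
      by (intro nn_integral_cong)
         (use measurable_space[OF U] measurable_space[OF V] in \<open>auto simp: space_pair_measure G[symmetric] split: split_indicator
            intro!: arg_cong[where f = "emeasure M"]\<close>)
    also have "\<dots> = (\<integral>\<^sup>+x. ennreal (exponential_density l x) * (indicator {u<..} x * G (x - u)) \<partial>lborel)"
      by (rule distributed_nn_integral[OF D, symmetric]) measurable
    finally show ?thesis .
  qed
  have all: "emeasure M {\<omega>\<in>space M. (g (U \<omega>), V \<omega>) \<in> A} =
      (\<integral>\<^sup>+x. ennreal (exponential_density l x) * G x \<partial>lborel)"
  proof -
    have "emeasure M {\<omega>\<in>space M. (g (U \<omega>), V \<omega>) \<in> A} =
        emeasure M {\<omega>\<in>space M. (U \<omega>, V \<omega>) \<in> {z\<in>space (S \<Otimes>\<^sub>M T). (g (fst z), snd z) \<in> A}}"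
      by (intro arg_cong[where f = "emeasure M"])
         (use measurable_space[OF U] measurable_space[OF V] in \<open>auto simp: space_pair_measure\<close>)
    also have "\<dots> = (\<integral>\<^sup>+\<omega>. emeasure M {\<omega>'\<in>space M. (U \<omega>, V \<omega>') \<in>
        {z\<in>space (S \<Otimes>\<^sub>M T). (g (fst z), snd z) \<in> A}} \<partial>M)"
      by (rule emeasure_indep_var_Pair[OF ind]) measurable
    also have "\<dots> = (\<integral>\<^sup>+\<omega>. G (g (U \<omega>)) \<partial>M)"
      by (intro nn_integral_cong)
         (use measurable_space[OF U] measurable_space[OF V] in \<open>auto simp: space_pair_measure G[symmetric]
            intro!: arg_cong[where f = "emeasure M"]\<close>)
    also have "\<dots> = (\<integral>\<^sup>+x. ennreal (exponential_density l x) * G x \<partial>lborel)"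
      by (rule distributed_nn_integral[OF D, symmetric]) measurable
    finally show ?thesis .
  qed
  have "(\<integral>\<^sup>+x. ennreal (exponential_density l x) * (indicator {u<..} x * G (x - u)) \<partial>lborel) =
      (\<integral>\<^sup>+x. ennreal (exponential_density l (u + x)) * (indicator {u<..} (u + x) * G x) \<partial>lborel)"
    by (subst nn_integral_real_affine[where c = 1 and t = u]) (simp_all add: algebra_simps)
  also have "\<dots> = (\<integral>\<^sup>+x. ennreal (exp (- l * u)) * (ennreal (exponential_density l x) * G x) \<partial>lborel)"
  proof (rule nn_integral_cong_AE)
    \<comment> \<open>At \<open>x = 0\<close> the strict indicator vanishes but the density does
      not, so the identity is claimed off this null point.\<close>
    have "ennreal (exponential_density l (u + x)) * (indicator {u<..} (u + x) * G x) =
        ennreal (exp (- l * u)) * (ennreal (exponential_density l x) * G x)" if "x \<noteq> 0" for x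
    proof (cases "0 < x")
      case True
      then have "exponential_density l (u + x) = exp (- l * u) * exponential_density l x"
        using u by (simp add: exponential_density_def exp_add[symmetric] algebra_simps)
      then show ?thesis
        using True l by (simp add: ennreal_mult exponential_density_nonneg mult.assoc)
    next
      case False
      then show ?thesis using that by (simp add: exponential_density_def)
    qed
    then show "AE x in lborel. ennreal (exponential_density l (u + x)) * (indicator {u<..} (u + x) * G x) =
        ennreal (exp (- l * u)) * (ennreal (exponential_density l x) * G x)"
      using AE_lborel_singleton[of "0::real"] by (auto elim: eventually_mono)
  qed
  also have "\<dots> = ennreal (exp (- l * u)) * (\<integral>\<^sup>+x. ennreal (exponential_density l x) * G x \<partial>lborel)"
    by (rule nn_integral_cmult) measurable
  finally show ?thesis unfolding gt all .
qed

section \<open>Poisson increments\<close>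

locale exponential_renewals = prob_space +
  fixes Y :: "nat \<Rightarrow> 'a \<Rightarrow> real" and \<theta> :: real
  assumes rate_pos: "0 < \<theta>"
    and Y_exponential: "\<And>k. 1 \<le> k \<Longrightarrow> distributed M lborel (Y k) (exponential_density \<theta>)"
    and Y_indep: "indep_vars (\<lambda>_. borel) Y {1..}"
begin

lemma Y_measurable [measurable]: "1 \<le> k \<Longrightarrow> Y k \<in> borel_measurable M"
  using Y_indep by (auto simp: indep_vars_def)

lemma Y_sum_measurable [measurable]: "(\<lambda>\<omega>. \<Sum>j\<in>{Suc a..b}. Y j \<omega>) \<in> borel_measurable M"
  by (rule borel_measurable_sum) simp

lemma AE_Y_pos: "AE \<omega> in M. \<forall>k\<ge>1. 0 < Y k \<omega>"
proof -
  have "AE \<omega> in M. 0 < Y k \<omega>" if k: "1 \<le> k" for k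
  proof -
    have "prob {\<omega>\<in>space M. 0 < Y k \<omega>} = 1"
      using exponential_distributedD_gt[OF Y_exponential[OF k] order_refl rate_pos] by simp
    then show ?thesis using k by (subst (asm) prob_Collect_eq_1) simp_all
  qed
  then show ?thesis by (simp add: AE_all_countable)
qed

text \<open>The Erlang index starts at 0 for a single exponential, hence \<open>Suc d\<close> gaps
  for index \<open>d\<close>. The offset \<open>a\<close> allows blocks that begin after an
  arbitrary number of renewals.\<close>

lemma prob_block_sum_le:
  assumes "0 \<le> h"
  shows "prob {\<omega>\<in>space M. (\<Sum>j=Suc a..a + Suc d. Y j \<omega>) \<le> h} = erlang_CDF d \<theta> h"
proof -
  have "distributed M lborel (\<lambda>\<omega>. \<Sum>j\<in>{Suc a..a + Suc d}. Y j \<omega>)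
      (erlang_density (card {Suc a..a + Suc d} - 1) \<theta>)"
    by (rule exponential_distributed_sum)
       (auto intro!: rate_pos Y_exponential indep_vars_subset[OF Y_indep])
  then show ?thesis using erlang_distributed_le[OF _ rate_pos assms] by simp
qed

text \<open>Two consecutive Erlang distribution functions differ by exactly one Poisson term. The
  case \<open>d = 0\<close> has no Erlang law for the empty sum and is an exponential tail.\<close>

lemma prob_block_count:
  assumes h: "0 \<le> h"
  shows "prob {\<omega>\<in>space M. (\<Sum>j=Suc a..a + d. Y j \<omega>) \<le> h \<and> h < (\<Sum>j=Suc a..a + Suc d. Y j \<omega>)} =
    pmf (poisson0_pmf (\<theta> * h)) d"
proof (cases d)
  case 0
  then show ?thesis
    using h rate_pos exponential_distributedD_gt[OF Y_exponential[of "Suc a"] h rate_pos]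
    by (simp add: pmf_poisson0 mult.commute)
next
  case (Suc e)
  let ?T = "\<lambda>d \<omega>. \<Sum>j=Suc a..a + d. Y j \<omega>"
  have "prob {\<omega>\<in>space M. ?T d \<omega> \<le> h \<and> h < ?T (Suc d) \<omega>} =
      prob ({\<omega>\<in>space M. ?T d \<omega> \<le> h} - {\<omega>\<in>space M. ?T d \<omega> \<le> h \<and> ?T (Suc d) \<omega> \<le> h})"
    by (intro arg_cong[where f = prob]) auto
  also have "\<dots> = prob {\<omega>\<in>space M. ?T d \<omega> \<le> h} - prob {\<omega>\<in>space M. ?T d \<omega> \<le> h \<and> ?T (Suc d) \<omega> \<le> h}"
    by (rule finite_measure_Diff) (auto simp del: sum.cl_ivl_Suc)
  \<comment> \<open>Gaps are positive almost surely, so a longer block that ends by \<open>h\<close>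
    forces the shorter one to do so.\<close>
  also have "prob {\<omega>\<in>space M. ?T d \<omega> \<le> h \<and> ?T (Suc d) \<omega> \<le> h} = prob {\<omega>\<in>space M. ?T (Suc d) \<omega> \<le> h}"
  proof (rule finite_measure_eq_AE)
    show "AE \<omega> in M. (\<omega> \<in> {\<omega>\<in>space M. ?T d \<omega> \<le> h \<and> ?T (Suc d) \<omega> \<le> h}) =
        (\<omega> \<in> {\<omega>\<in>space M. ?T (Suc d) \<omega> \<le> h})"
      using AE_Y_pos
    proof eventually_elim
      case (elim \<omega>)
      then have "0 < Y (Suc (a + d)) \<omega>" by simp
      then show ?case by auto
    qed
  qed (auto simp del: sum.cl_ivl_Suc)
  also have "prob {\<omega>\<in>space M. ?T d \<omega> \<le> h} = erlang_CDF e \<theta> h"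
    unfolding Suc by (rule prob_block_sum_le[OF h])
  also have "prob {\<omega>\<in>space M. ?T (Suc d) \<omega> \<le> h} = erlang_CDF d \<theta> h"
    by (rule prob_block_sum_le[OF h])
  also have "erlang_CDF e \<theta> h - erlang_CDF d \<theta> h = pmf (poisson0_pmf (\<theta> * h)) d"
    using h rate_pos by (simp add: erlang_CDF_def Suc pmf_poisson0)
  finally show ?thesis .
qed

text \<open>The chance that the sum of the first \<open>k + 1\<close> gaps is at most
  \<open>b\<close> is a Poisson tail beyond \<open>k\<close>, which tends to 0. Countably many
  integer bounds \<open>b\<close> suffice.\<close>

lemma AE_Y_sum_unbounded: "AE \<omega> in M. \<forall>b. \<exists>k. b < (\<Sum>j=1..k. Y j \<omega>)"
proof -
  have "AE \<omega> in M. \<exists>k. real b < (\<Sum>j=1..k. Y j \<omega>)" for b :: nat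
  proof (rule AE_I')
    let ?A = "{\<omega>\<in>space M. \<forall>k. (\<Sum>j=1..k. Y j \<omega>) \<le> real b}"
    have "prob ?A \<le> 0"
    proof (rule LIMSEQ_le_const)
      have "(\<lambda>k. \<Sum>n\<le>k. pmf (poisson0_pmf (\<theta> * b)) n) \<longlonglongrightarrow> 1"
      proof -
        have "pmf (poisson0_pmf (\<theta> * b)) sums 1"
          using pmf_has_sum[of "poisson0_pmf (\<theta> * b)"] by (rule has_sum_imp_sums)
        then show ?thesis by (simp add: sums_def_le)
      qed
      then have "(\<lambda>k. 1 - (\<Sum>n\<le>k. pmf (poisson0_pmf (\<theta> * b)) n)) \<longlonglongrightarrow> 1 - 1"
        by (intro tendsto_diff tendsto_const)
      then show "(\<lambda>k. erlang_CDF k \<theta> (real b)) \<longlonglongrightarrow> 0"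
        using rate_pos by (simp add: erlang_CDF_def pmf_poisson0)
      have "prob ?A \<le> erlang_CDF k \<theta> (real b)" for k
        unfolding prob_block_sum_le[of "real b" 0 k, OF of_nat_0_le_iff, symmetric]
        by (rule finite_measure_mono) (auto simp del: sum.cl_ivl_Suc)
      then show "\<exists>N. \<forall>k\<ge>N. prob ?A \<le> erlang_CDF k \<theta> (real b)" by blast
    qed
    then have "prob ?A = 0" by (simp add: measure_le_0_iff)
    then show "?A \<in> null_sets M" by (intro null_setsI) (simp_all add: emeasure_eq_measure)
    show "{\<omega>\<in>space M. \<not> (\<exists>k. real b < (\<Sum>j=1..k. Y j \<omega>))} \<subseteq> ?A" by (auto simp: not_less)
  qed
  then have "AE \<omega> in M. \<forall>b::nat. \<exists>k. real b < (\<Sum>j=1..k. Y j \<omega>)"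
    by (simp add: AE_all_countable)
  then show ?thesis
    by (rule AE_mp) (intro AE_I2 impI allI, meson real_arch_simple le_less_trans)
qed

text \<open>If the first gap of a block outlasts age \<open>u\<close>, its residual life together
  with the later gaps forms a fresh block. This factor is what makes increments independent of the
  age of the running gap.\<close>

lemma prob_overshoot_block_count:
  assumes u: "0 \<le> u" and h: "0 \<le> h"
  shows "emeasure M {\<omega>\<in>space M. u < Y (Suc a) \<omega> \<and> (\<Sum>j=Suc a..a + d. Y j \<omega>) \<le> u + h \<and>
      u + h < (\<Sum>j=Suc a..a + Suc d. Y j \<omega>)} =
    ennreal (exp (- \<theta> * u)) * ennreal (pmf (poisson0_pmf (\<theta> * h)) d)"
proof (cases d)
  \<comment> \<open>The sum over the first \<open>d\<close> gaps is empty here, so it cannot be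
    split into first gap plus rest; the event is a plain tail at \<open>u + h\<close>.\<close>
  case 0
  have "emeasure M {\<omega>\<in>space M. u + h < Y (Suc a) \<omega>} = ennreal (exp (- (u + h) * \<theta>))"
    using u h exponential_distributedD_gt[OF Y_exponential[of "Suc a"] _ rate_pos, of "u + h"]
    by (simp add: emeasure_eq_measure)
  moreover have "{\<omega>\<in>space M. u < Y (Suc a) \<omega> \<and> (\<Sum>j=Suc a..a + d. Y j \<omega>) \<le> u + h \<and>
      u + h < (\<Sum>j=Suc a..a + Suc d. Y j \<omega>)} = {\<omega>\<in>space M. u + h < Y (Suc a) \<omega>}"
    using 0 u h by auto
  ultimately show ?thesis
    using 0 h rate_pos by (simp add: pmf_poisson0 ennreal_mult'[symmetric] exp_add[symmetric] algebra_simps)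
next
  case (Suc e)
  let ?B = "{Suc (Suc a)..a + Suc d}"
  let ?U = "\<lambda>\<omega>. \<lambda>k\<in>{Suc a}. Y k \<omega>" and ?V = "\<lambda>\<omega>. \<lambda>k\<in>?B. Y k \<omega>"
  let ?PV = "PiM ?B (\<lambda>_. borel :: real measure)"
  let ?A = "{z\<in>space (borel \<Otimes>\<^sub>M ?PV). fst z + (\<Sum>j=Suc (Suc a)..a + d. snd z j) \<le> h \<and>
    h < fst z + (\<Sum>j=Suc (Suc a)..a + Suc d. snd z j)}"
  have ind: "indep_var (PiM {Suc a} (\<lambda>_. borel)) ?U ?PV ?V"
    by (rule indep_var_restrict[OF Y_indep]) auto
  have V: "?V \<omega> \<in> space ?PV" for \<omega> by (auto simp: space_PiM PiE_def extensional_def)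
  have sV: "(\<Sum>j=Suc (Suc a)..a + e. ?V \<omega> j) = (\<Sum>j=Suc (Suc a)..a + e. Y j \<omega>)" if "e \<le> Suc d" for \<omega> e
    using that by (intro sum.cong) auto
  have mV: "(\<lambda>z. \<Sum>j=Suc (Suc a)..a + e. snd z j) \<in> borel_measurable (borel \<Otimes>\<^sub>M ?PV)" if "e \<le> Suc d" for e
    using that by (intro borel_measurable_sum measurable_compose[OF measurable_snd] measurable_component_singleton) auto
  note [measurable] = mV[of d, OF le_SucI[OF order_refl]] mV[of "Suc d", OF order_refl]
  have A: "?A \<in> sets (borel \<Otimes>\<^sub>M ?PV)" by measurable
  have memA: "(x, ?V \<omega>) \<in> ?A \<longleftrightarrow> x + (\<Sum>j=Suc (Suc a)..a + d. Y j \<omega>) \<le> h \<and>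
      h < x + (\<Sum>j=Suc (Suc a)..a + Suc d. Y j \<omega>)" for x \<omega>
    by (simp only: mem_Collect_eq space_pair_measure mem_Sigma_iff V space_borel UNIV_I simp_thms
        fst_conv snd_conv sV[OF le_SucI[OF order_refl]] sV[OF order_refl])
  have split: "(\<Sum>j=Suc a..a + d. Y j \<omega>) = Y (Suc a) \<omega> + (\<Sum>j=Suc (Suc a)..a + d. Y j \<omega>)"
    "(\<Sum>j=Suc a..a + Suc d. Y j \<omega>) = Y (Suc a) \<omega> + (\<Sum>j=Suc (Suc a)..a + Suc d. Y j \<omega>)" for \<omega>
    unfolding Suc by (rule sum.atLeast_Suc_atMost, simp)+
  have U: "?U \<omega> (Suc a) = Y (Suc a) \<omega>" for \<omega> by simp
  have shift: "y + v \<le> u + h \<and> u + h < y + w \<longleftrightarrow> (y - u) + v \<le> h \<and> h < (y - u) + w" for y v w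
    by auto
  have "emeasure M {\<omega>\<in>space M. u < Y (Suc a) \<omega> \<and> (\<Sum>j=Suc a..a + d. Y j \<omega>) \<le> u + h \<and>
      u + h < (\<Sum>j=Suc a..a + Suc d. Y j \<omega>)} =
      emeasure M {\<omega>\<in>space M. u < ?U \<omega> (Suc a) \<and> (?U \<omega> (Suc a) - u, ?V \<omega>) \<in> ?A}"
    by (simp only: U memA split shift)
  also have "\<dots> = ennreal (exp (- \<theta> * u)) * emeasure M {\<omega>\<in>space M. (?U \<omega> (Suc a), ?V \<omega>) \<in> ?A}"
  proof (rule exponential_memoryless_joint[OF rate_pos _ ind _ A u])
    show "distributed M lborel (\<lambda>\<omega>. ?U \<omega> (Suc a)) (exponential_density \<theta>)"
      unfolding U by (rule Y_exponential) simp
  qed simp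
  also have "\<dots> = ennreal (exp (- \<theta> * u)) * ennreal (pmf (poisson0_pmf (\<theta> * h)) d)"
    by (simp only: U memA split[symmetric] prob_block_count[OF h] emeasure_eq_measure)
  finally show ?thesis .
qed

text \<open>Given the first \<open>m\<close> gaps, gap \<open>m + 1\<close> straddles
  \<open>s\<close> with age \<open>s\<close> minus the \<open>m\<close>-th epoch. The overshoot
  lemma with that age as \<open>u\<close> yields a Poisson factor free of the age, so it can be
  pulled out of the integral over the past.\<close>

lemma prob_count_after_history:
  assumes C [measurable]: "C \<in> sets (PiM {1..m} (\<lambda>_. borel))" and h: "0 \<le> h"
  shows "prob {\<omega>\<in>space M. ((\<lambda>k\<in>{1..m}. Y k \<omega>) \<in> C \<and> (\<Sum>j=1..m. Y j \<omega>) \<le> s \<and> s < (\<Sum>j=1..Suc m. Y j \<omega>)) \<and>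
      (\<Sum>j=1..m + d. Y j \<omega>) \<le> s + h \<and> s + h < (\<Sum>j=1..Suc (m + d). Y j \<omega>)} =
    prob {\<omega>\<in>space M. (\<lambda>k\<in>{1..m}. Y k \<omega>) \<in> C \<and> (\<Sum>j=1..m. Y j \<omega>) \<le> s \<and> s < (\<Sum>j=1..Suc m. Y j \<omega>)} *
    pmf (poisson0_pmf (\<theta> * h)) d"
proof -
  let ?U = "\<lambda>\<omega>. \<lambda>k\<in>{1..m}. Y k \<omega>"
  define I where "I = (\<integral>\<^sup>+\<omega>. indicator {x\<in>C. (\<Sum>j=1..m. x j) \<le> s} (?U \<omega>) *
    ennreal (exp (- \<theta> * (s - (\<Sum>j=1..m. Y j \<omega>)))) \<partial>M)"
  have *: "emeasure M {\<omega>\<in>space M. (?U \<omega> \<in> C \<and> (\<Sum>j=1..m. Y j \<omega>) \<le> s \<and> s < (\<Sum>j=1..Suc m. Y j \<omega>)) \<and>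
      (\<Sum>j=1..m + d. Y j \<omega>) \<le> s + h \<and> s + h < (\<Sum>j=1..Suc (m + d). Y j \<omega>)} =
      I * ennreal (pmf (poisson0_pmf (\<theta> * h)) d)" if h: "0 \<le> h" for d h
  proof -
    let ?B = "{Suc m..m + Suc d}"
    let ?V = "\<lambda>\<omega>. \<lambda>k\<in>?B. Y k \<omega>"
    let ?PU = "PiM {1..m} (\<lambda>_. borel :: real measure)" and ?PV = "PiM ?B (\<lambda>_. borel :: real measure)"
    let ?A = "{z\<in>space (?PU \<Otimes>\<^sub>M ?PV). fst z \<in> C \<and> (\<Sum>j=1..m. fst z j) \<le> s \<and> s < (\<Sum>j=1..m. fst z j) + snd z (Suc m) \<and>
      (\<Sum>j=1..m. fst z j) + (\<Sum>j=Suc m..m + d. snd z j) \<le> s + h \<and>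
      s + h < (\<Sum>j=1..m. fst z j) + (\<Sum>j=Suc m..m + Suc d. snd z j)}"
    have ind: "indep_var ?PU ?U ?PV ?V"
      by (rule indep_var_restrict[OF Y_indep]) auto
    have UV: "?U \<omega> \<in> space ?PU" "?V \<omega> \<in> space ?PV" for \<omega>
      by (auto simp: space_PiM PiE_def extensional_def)
    have msU: "(\<lambda>z. \<Sum>j=1..m. fst z j) \<in> borel_measurable (?PU \<Otimes>\<^sub>M ?PV)"
      by (intro borel_measurable_sum measurable_compose[OF measurable_fst] measurable_component_singleton) auto
    have msV: "(\<lambda>z. \<Sum>j=Suc m..m + e. snd z j) \<in> borel_measurable (?PU \<Otimes>\<^sub>M ?PV)" if "e \<le> Suc d" for e
      using that by (intro borel_measurable_sum measurable_compose[OF measurable_snd] measurable_component_singleton) auto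
    have mV1: "(\<lambda>z. snd z (Suc m)) \<in> borel_measurable (?PU \<Otimes>\<^sub>M ?PV)"
      by (intro measurable_compose[OF measurable_snd] measurable_component_singleton) auto
    note [measurable] = msU mV1 msV[of d, OF le_SucI[OF order_refl]] msV[of "Suc d", OF order_refl]
    have A: "?A \<in> sets (?PU \<Otimes>\<^sub>M ?PV)" by measurable
    have cat: "(\<Sum>j=1..m. f j) + (\<Sum>j=Suc m..m + e. f j) = (\<Sum>j=1..m + e. f j)" for f :: "nat \<Rightarrow> real" and e
      using sum.ub_add_nat[of 1 m f e] by simp
    have sU: "(\<Sum>j=1..m. ?U \<omega> j) = (\<Sum>j=1..m. Y j \<omega>)" for \<omega> by (rule sum.cong) auto
    have sV: "(\<Sum>j=Suc m..m + e. ?V \<omega> j) = (\<Sum>j=Suc m..m + e. Y j \<omega>)" if "e \<le> Suc d" for \<omega> e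
      using that by (intro sum.cong) auto
    have V1: "?V \<omega> (Suc m) = Y (Suc m) \<omega>" for \<omega> by simp
    have memA: "(?U \<omega>, ?V \<omega>') \<in> ?A \<longleftrightarrow> ?U \<omega> \<in> C \<and> (\<Sum>j=1..m. Y j \<omega>) \<le> s \<and>
        s < (\<Sum>j=1..m. Y j \<omega>) + Y (Suc m) \<omega>' \<and>
        (\<Sum>j=1..m. Y j \<omega>) + (\<Sum>j=Suc m..m + d. Y j \<omega>') \<le> s + h \<and>
        s + h < (\<Sum>j=1..m. Y j \<omega>) + (\<Sum>j=Suc m..m + Suc d. Y j \<omega>')" for \<omega> \<omega>'
      by (simp only: mem_Collect_eq space_pair_measure mem_Sigma_iff UV simp_thms
          fst_conv snd_conv sU V1 sV[OF le_SucI[OF order_refl]] sV[OF order_refl])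
    have c: "(\<Sum>j=1..Suc m. Y j \<omega>) = (\<Sum>j=1..m. Y j \<omega>) + Y (Suc m) \<omega>"
      "(\<Sum>j=1..m + d. Y j \<omega>) = (\<Sum>j=1..m. Y j \<omega>) + (\<Sum>j=Suc m..m + d. Y j \<omega>)"
      "(\<Sum>j=1..Suc (m + d). Y j \<omega>) = (\<Sum>j=1..m. Y j \<omega>) + (\<Sum>j=Suc m..m + Suc d. Y j \<omega>)" for \<omega>
      using cat[of "\<lambda>j. Y j \<omega>" d] cat[of "\<lambda>j. Y j \<omega>" "Suc d"] by simp_all
    have "emeasure M {\<omega>\<in>space M. (?U \<omega> \<in> C \<and> (\<Sum>j=1..m. Y j \<omega>) \<le> s \<and> s < (\<Sum>j=1..Suc m. Y j \<omega>)) \<and>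
        (\<Sum>j=1..m + d. Y j \<omega>) \<le> s + h \<and> s + h < (\<Sum>j=1..Suc (m + d). Y j \<omega>)} =
        emeasure M {\<omega>\<in>space M. (?U \<omega>, ?V \<omega>) \<in> ?A}"
      by (simp only: memA c conj_assoc)
    also have "\<dots> = (\<integral>\<^sup>+\<omega>. emeasure M {\<omega>'\<in>space M. (?U \<omega>, ?V \<omega>') \<in> ?A} \<partial>M)"
      by (rule emeasure_indep_var_Pair[OF ind A])
    also have "\<dots> = (\<integral>\<^sup>+\<omega>. (indicator {x\<in>C. (\<Sum>j=1..m. x j) \<le> s} (?U \<omega>) *
        ennreal (exp (- \<theta> * (s - (\<Sum>j=1..m. Y j \<omega>))))) * ennreal (pmf (poisson0_pmf (\<theta> * h)) d) \<partial>M)"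
    proof (rule nn_integral_cong)
      fix \<omega>
      let ?S = "\<Sum>j=1..m. Y j \<omega>"
      show "emeasure M {\<omega>'\<in>space M. (?U \<omega>, ?V \<omega>') \<in> ?A} =
        (indicator {x\<in>C. (\<Sum>j=1..m. x j) \<le> s} (?U \<omega>) * ennreal (exp (- \<theta> * (s - ?S)))) *
        ennreal (pmf (poisson0_pmf (\<theta> * h)) d)"
      proof (cases "?U \<omega> \<in> C \<and> ?S \<le> s")
        case True
        have shift: "s < ?S + y \<and> ?S + v \<le> s + h \<and> s + h < ?S + w \<longleftrightarrow>
            s - ?S < y \<and> v \<le> (s - ?S) + h \<and> (s - ?S) + h < w" for y v w
          by auto
        have "{\<omega>'\<in>space M. (?U \<omega>, ?V \<omega>') \<in> ?A} = {\<omega>'\<in>space M. s - ?S < Y (Suc m) \<omega>' \<and>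
            (\<Sum>j=Suc m..m + d. Y j \<omega>') \<le> (s - ?S) + h \<and> (s - ?S) + h < (\<Sum>j=Suc m..m + Suc d. Y j \<omega>')}"
          by (simp only: memA True shift simp_thms)
        then show ?thesis
          using True prob_overshoot_block_count[of "s - ?S" h m d] h
          by (simp only: sU mem_Collect_eq indicator_simps diff_ge_0_iff_ge mult_1_left simp_thms)
      next
        case False
        then have "{\<omega>'\<in>space M. (?U \<omega>, ?V \<omega>') \<in> ?A} = {}" by (auto simp only: memA)
        moreover have "?U \<omega> \<notin> {x\<in>C. (\<Sum>j=1..m. x j) \<le> s}" using False by (simp only: sU mem_Collect_eq) blast
        then have "indicator {x\<in>C. (\<Sum>j=1..m. x j) \<le> s} (?U \<omega>) = (0::ennreal)"
          by (rule indicator_simps)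
        ultimately show ?thesis by (simp only: emeasure_empty mult_zero_left)
      qed
    qed
    also have "\<dots> = I * ennreal (pmf (poisson0_pmf (\<theta> * h)) d)"
      unfolding I_def
    proof (rule nn_integral_multc)
      have [measurable]: "?U \<in> M \<rightarrow>\<^sub>M ?PU" using ind by (rule indep_var_rv1)
      have [measurable]: "(\<lambda>x. \<Sum>j=1..m. x j) \<in> borel_measurable ?PU"
        by (intro borel_measurable_sum measurable_component_singleton)
      have "{x\<in>C. (\<Sum>j=1..m. x j) \<le> s} = C \<inter> {x\<in>space ?PU. (\<Sum>j=1..m. x j) \<le> s}"
        using sets.sets_into_space[OF C] by auto
      also have "\<dots> \<in> sets ?PU" by measurable
      finally have [measurable]: "{x\<in>C. (\<Sum>j=1..m. x j) \<le> s} \<in> sets ?PU" .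
      show "(\<lambda>\<omega>. indicator {x\<in>C. (\<Sum>j=1..m. x j) \<le> s} (?U \<omega>) *
        ennreal (exp (- \<theta> * (s - (\<Sum>j=1..m. Y j \<omega>))))) \<in> borel_measurable M"
        by measurable
    qed
    finally show ?thesis .
  qed
  \<comment> \<open>Taking \<open>d = 0\<close> and \<open>h = 0\<close> makes the future event
    repeat the present one, with Poisson mass 1, so \<open>I\<close> is the probability of the
    history alone.\<close>
  have I: "emeasure M {\<omega>\<in>space M. ?U \<omega> \<in> C \<and> (\<Sum>j=1..m. Y j \<omega>) \<le> s \<and> s < (\<Sum>j=1..Suc m. Y j \<omega>)} = I"
    using *[of 0 0] by (simp add: pmf_poisson0 conj_ac del: sum.cl_ivl_Suc)
  have aux: "prob A = prob B * c" if "emeasure M B = I" "emeasure M A = I * ennreal c" "0 \<le> c" for A B c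
  proof -
    have "ennreal (prob A) = ennreal (prob B * c)"
      unfolding ennreal_mult'[OF measure_nonneg] emeasure_eq_measure[symmetric] that ..
    then show ?thesis using \<open>0 \<le> c\<close> by (subst (asm) ennreal_inj) simp_all
  qed
  show ?thesis by (rule aux[OF I *[OF h] pmf_nonneg])
qed

end

section \<open>The reflected random walk as a Markov chain\<close>

lemma measure_bind_pmf_map_bernoulli:
  assumes "0 \<le> p" "p \<le> 1"
  shows "measure (bind_pmf q (\<lambda>i. map_pmf (\<lambda>b. f b i) (bernoulli_pmf p))) D =
    p * measure q {i. f True i \<in> D} + (1 - p) * measure q {i. f False i \<in> D}"
proof -
  have "bind_pmf q (\<lambda>i. map_pmf (\<lambda>b. f b i) (bernoulli_pmf p)) =
      bind_pmf (bernoulli_pmf p) (\<lambda>b. map_pmf (f b) q)"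
    unfolding map_pmf_def by (rule bind_commute_pmf)
  also have "emeasure \<dots> D = (\<integral>\<^sup>+b. emeasure (map_pmf (f b) q) D \<partial>bernoulli_pmf p)"
    by (rule emeasure_bind_pmf)
  also have "\<dots> = ennreal (p * measure q {i. f True i \<in> D} + (1 - p) * measure q {i. f False i \<in> D})"
    using assms by (simp add: measure_pmf.emeasure_eq_measure vimage_def ennreal_plus ennreal_mult' mult.commute)
  finally show ?thesis
    using assms by (subst (asm) measure_pmf.emeasure_eq_measure, subst (asm) ennreal_inj) simp_all
qed

definition reflected_walk_kernel :: "real \<Rightarrow> nat \<Rightarrow> nat pmf" where
  "reflected_walk_kernel p i = map_pmf (\<lambda>b. if b then Suc i else i - 1) (bernoulli_pmf p)"

lemma reflected_walk_cong:
  "(\<And>k. 1 \<le> k \<Longrightarrow> k \<le> n \<Longrightarrow> c k = c' k) \<Longrightarrow> reflected_walk c n = reflected_walk c' n"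
  by (induction n) auto

lemma measurable_reflected_walk:
  assumes "\<And>k. 1 \<le> k \<Longrightarrow> k \<le> n \<Longrightarrow> (\<lambda>\<omega>. c \<omega> k) \<in> borel_measurable M"
  shows "(\<lambda>\<omega>. reflected_walk (c \<omega>) n) \<in> M \<rightarrow>\<^sub>M count_space UNIV"
  using assms
proof (induction n)
  case (Suc n)
  have [measurable]: "(\<lambda>\<omega>. reflected_walk (c \<omega>) n) \<in> M \<rightarrow>\<^sub>M count_space UNIV"
    using Suc by simp
  have [measurable]: "(\<lambda>\<omega>. c \<omega> (Suc n)) \<in> borel_measurable M"
    using Suc.prems by simp
  show ?case by simp
qed simp

locale random_steps = prob_space +
  fixes chi :: "nat \<Rightarrow> 'a \<Rightarrow> real" and p :: real
  assumes chi_indep: "indep_vars (\<lambda>_. borel) chi {1..}"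
    and chi_up: "\<And>k. 1 \<le> k \<Longrightarrow> prob {\<omega>\<in>space M. chi k \<omega> = 1} = p"
    and chi_down: "\<And>k. 1 \<le> k \<Longrightarrow> prob {\<omega>\<in>space M. chi k \<omega> = - 1} = 1 - p"
begin

lemma p_bounds: "0 \<le> p" "p \<le> 1"
  using chi_up[of 1] by (metis measure_nonneg order_refl, metis prob_le_1 order_refl)

lemma chi_measurable [measurable]: "1 \<le> k \<Longrightarrow> chi k \<in> borel_measurable M"
  using chi_indep by (auto simp: indep_vars_def)

lemma AE_chi: "AE \<omega> in M. \<forall>k\<ge>1. chi k \<omega> = 1 \<or> chi k \<omega> = - 1"
proof -
  have "AE \<omega> in M. chi k \<omega> = 1 \<or> chi k \<omega> = - 1" if k [measurable]: "1 \<le> k" for k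
  proof -
    have "prob {\<omega>\<in>space M. chi k \<omega> = 1 \<or> chi k \<omega> = - 1} =
        prob ({\<omega>\<in>space M. chi k \<omega> = 1} \<union> {\<omega>\<in>space M. chi k \<omega> = - 1})"
      by (rule arg_cong[where f = prob]) auto
    also have "\<dots> = p + (1 - p)"
      by (subst finite_measure_Union) (auto simp: chi_up[OF k] chi_down[OF k])
    finally have "prob {\<omega>\<in>space M. chi k \<omega> = 1 \<or> chi k \<omega> = - 1} = 1" by simp
    then show ?thesis by (subst (asm) prob_Collect_eq_1) simp_all
  qed
  then show ?thesis by (simp add: AE_all_countable)
qed

text \<open>The recursion tests only whether a step equals \<open>1\<close>, so the probability
  needed for its other branch is that of the complement.\<close>

lemma prob_chi_not_up:
  assumes [measurable]: "1 \<le> k"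
  shows "prob {\<omega>\<in>space M. chi k \<omega> \<noteq> 1} = 1 - p"
  using prob_neg[of "\<lambda>\<omega>. chi k \<omega> = 1"] chi_up[OF assms] by simp

lemma walk_measurable [measurable]:
  "(\<lambda>\<omega>. reflected_walk (\<lambda>k. chi k \<omega>) n) \<in> M \<rightarrow>\<^sub>M count_space UNIV"
  by (rule measurable_reflected_walk) simp

text \<open>The induction peels off the last step, which replaces the target by its preimages under
  the up and down moves. These need not be singletons, hence the arbitrary set \<open>D\<close>. The
  event \<open>C\<close> may carry any further information on the past, provided it fixes the
  current state \<open>x\<close>.\<close>

lemma prob_walk_after_history:
  assumes C [measurable]: "C \<in> sets (PiM {1..m} (\<lambda>_. borel))"
    and x: "\<And>\<omega>. \<omega> \<in> space M \<Longrightarrow> (\<lambda>k\<in>{1..m}. chi k \<omega>) \<in> C \<Longrightarrow> reflected_walk (\<lambda>k. chi k \<omega>) m = x"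
  shows "prob {\<omega>\<in>space M. (\<lambda>k\<in>{1..m}. chi k \<omega>) \<in> C \<and> reflected_walk (\<lambda>k. chi k \<omega>) (m + d) \<in> D} =
    prob {\<omega>\<in>space M. (\<lambda>k\<in>{1..m}. chi k \<omega>) \<in> C} * measure (kernel_power (reflected_walk_kernel p) d x) D"
proof (induction d arbitrary: D)
  case 0
  have eq: "{\<omega>\<in>space M. (\<lambda>k\<in>{1..m}. chi k \<omega>) \<in> C \<and> reflected_walk (\<lambda>k. chi k \<omega>) m \<in> D} =
      (if x \<in> D then {\<omega>\<in>space M. (\<lambda>k\<in>{1..m}. chi k \<omega>) \<in> C} else {})"
    using x by auto
  show ?case unfolding add_0_right eq kernel_power.simps
    by (cases "x \<in> D")
       (simp_all only: if_True if_False measure_return_pmf indicator_eq_1_iff indicator_eq_0_iff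
          measure_empty mult_1_right mult_zero_right indicator_simps not_False_eq_True)
next
  case (Suc d)
  let ?H = "\<lambda>\<omega>. \<lambda>k\<in>{1..m + d}. chi k \<omega>" and ?W = "\<lambda>\<omega>. reflected_walk (\<lambda>k. chi k \<omega>) (m + d)"
  let ?PH = "PiM {1..m + d} (\<lambda>_. borel :: real measure)"
  let ?c = "\<lambda>\<omega>. chi (Suc (m + d)) \<omega>"
  have ind: "indep_var ?PH ?H (PiM {Suc (m + d)} (\<lambda>_. borel)) (\<lambda>\<omega>. \<lambda>k\<in>{Suc (m + d)}. chi k \<omega>)"
    by (rule indep_var_restrict[OF chi_indep]) auto
  have [measurable]: "(\<lambda>h. \<lambda>k\<in>{1..m}. h k) \<in> ?PH \<rightarrow>\<^sub>M PiM {1..m} (\<lambda>_. borel :: real measure)"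
    by (rule measurable_restrict_subset) auto
  have [measurable]: "(\<lambda>h. reflected_walk h (m + d)) \<in> ?PH \<rightarrow>\<^sub>M count_space UNIV"
    by (rule measurable_reflected_walk) simp
  \<comment> \<open>Step \<open>Suc (m + d)\<close> is independent of the first \<open>m + d\<close>
    steps, and these determine both the history and the current position.\<close>
  have step: "prob {\<omega>\<in>space M. ((\<lambda>k\<in>{1..m}. chi k \<omega>) \<in> C \<and> ?W \<omega> \<in> E) \<and> ?c \<omega> \<in> B} =
      prob {\<omega>\<in>space M. (\<lambda>k\<in>{1..m}. chi k \<omega>) \<in> C \<and> ?W \<omega> \<in> E} * prob {\<omega>\<in>space M. ?c \<omega> \<in> B}"
    if [measurable]: "B \<in> sets borel" for E B
  proof -
    let ?A1 = "{h\<in>space ?PH. (\<lambda>k\<in>{1..m}. h k) \<in> C \<and> reflected_walk h (m + d) \<in> E}"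
    let ?A2 = "{h\<in>space (PiM {Suc (m + d)} (\<lambda>_. borel :: real measure)). h (Suc (m + d)) \<in> B}"
    have H: "?H \<omega> \<in> space ?PH" for \<omega> by (auto simp: space_PiM PiE_def extensional_def)
    have r: "(\<lambda>k\<in>{1..m}. ?H \<omega> k) = (\<lambda>k\<in>{1..m}. chi k \<omega>)" for \<omega> by (rule restrict_ext) auto
    have w: "reflected_walk (?H \<omega>) (m + d) = ?W \<omega>" for \<omega> by (rule reflected_walk_cong) auto
    have V: "(\<lambda>k\<in>{Suc (m + d)}. chi k \<omega>) \<in> ?A2 \<longleftrightarrow> ?c \<omega> \<in> B" for \<omega>
      by (auto simp: space_PiM PiE_def extensional_def)
    have "prob {\<omega>\<in>space M. ?H \<omega> \<in> ?A1 \<and> (\<lambda>k\<in>{Suc (m + d)}. chi k \<omega>) \<in> ?A2} =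
        prob {\<omega>\<in>space M. ?H \<omega> \<in> ?A1} * prob {\<omega>\<in>space M. (\<lambda>k\<in>{Suc (m + d)}. chi k \<omega>) \<in> ?A2}"
      by (rule prob_indep_var_conj[OF ind]) measurable
    then show ?thesis by (simp only: V) (simp only: mem_Collect_eq H r w simp_thms)
  qed
  have meas: "(\<lambda>\<omega>. \<lambda>k\<in>{1..m}. chi k \<omega>) \<in> M \<rightarrow>\<^sub>M PiM {1..m} (\<lambda>_. borel)"
    by (rule measurable_restrict) simp
  have [measurable]: "Measurable.pred M (\<lambda>\<omega>. (\<lambda>k\<in>{1..m}. chi k \<omega>) \<in> C)"
    by (rule pred_sets2[OF C meas])
  have up: "prob {\<omega>\<in>space M. ?c \<omega> \<in> {1}} = p" and not_up: "prob {\<omega>\<in>space M. ?c \<omega> \<in> - {1}} = 1 - p"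
    using chi_up[of "Suc (m + d)"] prob_chi_not_up[of "Suc (m + d)"] by simp_all
  let ?p = "measure (kernel_power (reflected_walk_kernel p) d x)"
  have "prob {\<omega>\<in>space M. (\<lambda>k\<in>{1..m}. chi k \<omega>) \<in> C \<and> reflected_walk (\<lambda>k. chi k \<omega>) (m + Suc d) \<in> D} =
      prob ({\<omega>\<in>space M. ((\<lambda>k\<in>{1..m}. chi k \<omega>) \<in> C \<and> ?W \<omega> \<in> {i. Suc i \<in> D}) \<and> ?c \<omega> \<in> {1}} \<union>
        {\<omega>\<in>space M. ((\<lambda>k\<in>{1..m}. chi k \<omega>) \<in> C \<and> ?W \<omega> \<in> {i. i - 1 \<in> D}) \<and> ?c \<omega> \<in> - {1}})"
    by (intro arg_cong[where f = prob]) (auto split: if_splits)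
  also have "\<dots> =
      prob {\<omega>\<in>space M. ((\<lambda>k\<in>{1..m}. chi k \<omega>) \<in> C \<and> ?W \<omega> \<in> {i. Suc i \<in> D}) \<and> ?c \<omega> \<in> {1}} +
      prob {\<omega>\<in>space M. ((\<lambda>k\<in>{1..m}. chi k \<omega>) \<in> C \<and> ?W \<omega> \<in> {i. i - 1 \<in> D}) \<and> ?c \<omega> \<in> - {1}}"
    by (rule finite_measure_Union) (measurable, auto)
  also have "\<dots> = prob {\<omega>\<in>space M. (\<lambda>k\<in>{1..m}. chi k \<omega>) \<in> C} *
      (p * ?p {i. Suc i \<in> D} + (1 - p) * ?p {i. i - 1 \<in> D})"
    unfolding step[of "{1}", OF borel_singleton[OF sets.empty_sets]] step[of "- {1}", OF borel_comp[OF borel_singleton[OF sets.empty_sets]]] Suc.IH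
      up not_up by (simp only: distrib_left mult_ac)
  also have "p * ?p {i. Suc i \<in> D} + (1 - p) * ?p {i. i - 1 \<in> D} =
      measure (kernel_power (reflected_walk_kernel p) (Suc d) x) D"
    using measure_bind_pmf_map_bernoulli[OF p_bounds,
        of "kernel_power (reflected_walk_kernel p) d x" "\<lambda>b i. if b then Suc i else i - 1" D]
    by (simp add: reflected_walk_kernel_def[abs_def])
  finally show ?case .
qed

text \<open>The indices \<open>m k\<close> will be renewal counts at successive times, which may
  coincide; all that matters is that \<open>m n\<close> bounds them, so the history is an event of
  the first \<open>m n\<close> steps.\<close>

lemma prob_walk_Markov:
  fixes m x :: "nat \<Rightarrow> nat"
  assumes le: "\<And>k. k \<le> n \<Longrightarrow> m k \<le> m n"
  shows "prob {\<omega>\<in>space M. (\<forall>k\<le>n. reflected_walk (\<lambda>k. chi k \<omega>) (m k) = x k) \<and>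
      reflected_walk (\<lambda>k. chi k \<omega>) (m n + d) = y} =
    prob {\<omega>\<in>space M. \<forall>k\<le>n. reflected_walk (\<lambda>k. chi k \<omega>) (m k) = x k} *
    pmf (kernel_power (reflected_walk_kernel p) d (x n)) y"
proof -
  let ?PH = "PiM {1..m n} (\<lambda>_. borel :: real measure)" and ?H = "\<lambda>\<omega>. \<lambda>k\<in>{1..m n}. chi k \<omega>"
  let ?C = "{h\<in>space ?PH. \<forall>k\<le>n. reflected_walk h (m k) = x k}"
  have mw: "(\<lambda>h. reflected_walk h (m k)) \<in> ?PH \<rightarrow>\<^sub>M count_space UNIV" if "k \<le> n" for k
    using le[OF that] by (intro measurable_reflected_walk measurable_component_singleton) auto
  have C: "?C \<in> sets ?PH"
  proof -
    have "?C = (\<Inter>k\<in>{..n}. (\<lambda>h. reflected_walk h (m k)) -` {x k} \<inter> space ?PH)" by auto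
    also have "\<dots> \<in> sets ?PH" using mw by (intro sets.finite_INT measurable_sets) auto
    finally show ?thesis .
  qed
  have memC: "?H \<omega> \<in> ?C \<longleftrightarrow> (\<forall>k\<le>n. reflected_walk (\<lambda>k. chi k \<omega>) (m k) = x k)" for \<omega>
  proof -
    have "reflected_walk (?H \<omega>) (m k) = reflected_walk (\<lambda>k. chi k \<omega>) (m k)" if "k \<le> n" for k
      using le[OF that] by (intro reflected_walk_cong) auto
    moreover have "?H \<omega> \<in> space ?PH" by (auto simp: space_PiM PiE_def extensional_def)
    ultimately show ?thesis by auto
  qed
  have "prob {\<omega>\<in>space M. ?H \<omega> \<in> ?C \<and> reflected_walk (\<lambda>k. chi k \<omega>) (m n + d) \<in> {y}} =
      prob {\<omega>\<in>space M. ?H \<omega> \<in> ?C} * measure (kernel_power (reflected_walk_kernel p) d (x n)) {y}"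
  proof (rule prob_walk_after_history[OF C])
    fix \<omega> assume "?H \<omega> \<in> ?C"
    then show "reflected_walk (\<lambda>k. chi k \<omega>) (m n) = x n" unfolding memC by blast
  qed
  then show ?thesis by (simp only: memC pmf.rep_eq singleton_iff)
qed

end

section \<open>The time-changed walk\<close>

lemma all_le_Suc_iff: "(\<forall>k\<le>Suc n. P k) \<longleftrightarrow> (\<forall>k\<le>n. P k) \<and> P (Suc n)"
  by (auto simp: le_Suc_eq)

lemma (in prob_space) prob_cong_AE:
  assumes "AE \<omega> in M. P \<omega> \<longleftrightarrow> Q \<omega>"
    and "{\<omega>\<in>space M. P \<omega>} \<in> sets M" "{\<omega>\<in>space M. Q \<omega>} \<in> sets M"
  shows "prob {\<omega>\<in>space M. P \<omega>} = prob {\<omega>\<in>space M. Q \<omega>}"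
  using assms by (intro finite_measure_eq_AE) auto

locale renewal_subordinated_walk =
  exponential_renewals M Y \<theta> + random_steps M chi p
  for M :: "'a measure" and Y chi :: "nat \<Rightarrow> 'a \<Rightarrow> real" and \<theta> p :: real +
  assumes chi_Y_indep: "indep_var
    (\<Pi>\<^sub>M k\<in>{1..}. borel) (\<lambda>\<omega>. \<lambda>k\<in>{1..}. chi k \<omega>)
    (\<Pi>\<^sub>M k\<in>{1..}. borel) (\<lambda>\<omega>. \<lambda>k\<in>{1..}. Y k \<omega>)"
begin

abbreviation walk :: "nat \<Rightarrow> 'a \<Rightarrow> nat" where
  "walk n \<omega> \<equiv> reflected_walk (\<lambda>k. chi k \<omega>) n"

text \<open>An integer-valued version of the queue length, which agrees with it almost surely. The
  Markov property is proved for this version and then transferred.\<close>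

definition queue :: "real \<Rightarrow> 'a \<Rightarrow> nat" where
  "queue t \<omega> = walk (renewal_count Y t \<omega>) \<omega>"

lemma count_measurable [measurable]:
  "0 \<le> t \<Longrightarrow> renewal_count Y t \<in> M \<rightarrow>\<^sub>M count_space UNIV"
  by (rule measurable_renewal_count) simp

lemma queue_measurable [measurable]:
  assumes [measurable]: "0 \<le> t"
  shows "queue t \<in> M \<rightarrow>\<^sub>M count_space UNIV"
  unfolding queue_def[abs_def]
  by (rule measurable_compose_countable[OF walk_measurable]) measurable

lemma AE_count_eq_iff:
  "AE \<omega> in M. \<forall>t\<ge>0. \<forall>n. renewal_count Y t \<omega> = n \<longleftrightarrow>
    (\<Sum>j=1..n. Y j \<omega>) \<le> t \<and> t < (\<Sum>j=1..Suc n. Y j \<omega>)"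
  using AE_Y_pos AE_Y_sum_unbounded
proof eventually_elim
  case (elim \<omega>)
  show ?case
  proof (intro allI impI)
    fix t :: real and n assume "0 \<le> t"
    with elim show "renewal_count Y t \<omega> = n \<longleftrightarrow>
        (\<Sum>j=1..n. Y j \<omega>) \<le> t \<and> t < (\<Sum>j=1..Suc n. Y j \<omega>)"
      by (rule renewal_count_eq_iff)
  qed
qed

lemma AE_count_mono: "AE \<omega> in M. \<forall>s\<ge>0. \<forall>t\<ge>s. renewal_count Y s \<omega> \<le> renewal_count Y t \<omega>"
  using AE_count_eq_iff AE_Y_pos
proof eventually_elim
  case (elim \<omega>)
  have S: "strict_mono (\<lambda>k. \<Sum>j=1..k. Y j \<omega>)"
    by (rule strict_monoI_Suc) (use elim(2) in simp)
  show ?case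
  proof (intro allI impI)
    fix s t :: real assume st: "0 \<le> s" "s \<le> t"
    have "(\<Sum>j=1..renewal_count Y s \<omega>. Y j \<omega>) \<le> s" using elim(1) st by blast
    also have "s \<le> t" by fact
    also have "t < (\<Sum>j=1..Suc (renewal_count Y t \<omega>). Y j \<omega>)" using elim(1) st order_trans by blast
    finally show "renewal_count Y s \<omega> \<le> renewal_count Y t \<omega>"
      unfolding strict_mono_less[OF S] by simp
  qed
qed

text \<open>Almost surely the past counts amount to an event of the first \<open>m n\<close> gaps
  together with the next gap straddling \<open>t n\<close>, which is the form of history that the
  block lemma accepts.\<close>

lemma prob_count_Markov:
  fixes m :: "nat \<Rightarrow> nat"
  assumes t: "\<And>k. k \<le> n \<Longrightarrow> 0 \<le> t k \<and> t k \<le> t n" and tn: "t n \<le> t (Suc n)"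
    and m: "\<And>k. k \<le> n \<Longrightarrow> m k \<le> m n" and d: "m (Suc n) = m n + d"
  shows "prob {\<omega>\<in>space M. \<forall>k\<le>Suc n. renewal_count Y (t k) \<omega> = m k} =
    prob {\<omega>\<in>space M. \<forall>k\<le>n. renewal_count Y (t k) \<omega> = m k} *
    pmf (poisson0_pmf (\<theta> * (t (Suc n) - t n))) d"
proof -
  let ?PU = "PiM {1..m n} (\<lambda>_. borel :: real measure)" and ?U = "\<lambda>\<omega>. \<lambda>k\<in>{1..m n}. Y k \<omega>"
  let ?S = "\<lambda>k \<omega>. \<Sum>j=1..k. Y j \<omega>"
  \<comment> \<open>For \<open>m k = m n\<close> the upper bound would involve gap
    \<open>Suc (m n)\<close>, which is outside the first \<open>m n\<close> gaps. It is omitted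
    because it then follows from \<open>t k \<le> t n\<close> and the straddling condition at
    \<open>t n\<close>.\<close>
  let ?c = "\<lambda>y k. (\<Sum>j=1..m k. y j) \<le> t k \<and> (m k < m n \<longrightarrow> t k < (\<Sum>j=1..Suc (m k). y j))"
  let ?C = "{y\<in>space ?PU. \<forall>k\<in>{..n}. ?c y k}"
  have ms: "(\<lambda>y. \<Sum>j=1..i. y j) \<in> borel_measurable ?PU" if "i \<le> m n" for i
    using that by (intro borel_measurable_sum measurable_component_singleton) auto
  have C: "?C \<in> sets ?PU"
  proof (rule sets.sets_Collect_finite_All)
    fix k assume "k \<in> {..n}"
    then have k: "m k \<le> m n" using m by simp
    note [measurable] = ms[OF k]
    show "{y\<in>space ?PU. ?c y k} \<in> sets ?PU"
    proof (cases "m k < m n")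
      case True
      note [measurable] = ms[OF Suc_leI[OF True]]
      show ?thesis using True by (simp del: sum.cl_ivl_Suc)
    next
      case False
      show ?thesis by (simp only: False simp_thms) measurable
    qed
  qed simp
  have U: "?U \<omega> \<in> space ?PU" for \<omega> by (auto simp: space_PiM PiE_def extensional_def)
  have sU: "(\<Sum>j=1..i. ?U \<omega> j) = ?S i \<omega>" if "i \<le> m n" for i \<omega>
    using that by (intro sum.cong) auto
  have memC: "?U \<omega> \<in> ?C \<longleftrightarrow> (\<forall>k\<le>n. ?S (m k) \<omega> \<le> t k \<and> (m k < m n \<longrightarrow> t k < ?S (Suc (m k)) \<omega>))" for \<omega>
    using U[of \<omega>] sU m by (auto simp: Suc_le_eq simp del: sum.cl_ivl_Suc restrict_apply)
  have hist: "AE \<omega> in M. (\<forall>k\<le>n. renewal_count Y (t k) \<omega> = m k) \<longleftrightarrow>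
      ?U \<omega> \<in> ?C \<and> ?S (m n) \<omega> \<le> t n \<and> t n < ?S (Suc (m n)) \<omega>"
    using AE_count_eq_iff
  proof eventually_elim
    case (elim \<omega>)
    then have count: "renewal_count Y (t k) \<omega> = m k \<longleftrightarrow> ?S (m k) \<omega> \<le> t k \<and> t k < ?S (Suc (m k)) \<omega>" if "k \<le> n" for k
      using t[OF that] by blast
    show ?case
    proof
      assume "\<forall>k\<le>n. renewal_count Y (t k) \<omega> = m k"
      then have "\<forall>k\<le>n. ?S (m k) \<omega> \<le> t k \<and> t k < ?S (Suc (m k)) \<omega>" using count by blast
      then show "?U \<omega> \<in> ?C \<and> ?S (m n) \<omega> \<le> t n \<and> t n < ?S (Suc (m n)) \<omega>"
        unfolding memC by blast
    next
      assume *: "?U \<omega> \<in> ?C \<and> ?S (m n) \<omega> \<le> t n \<and> t n < ?S (Suc (m n)) \<omega>"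
      show "\<forall>k\<le>n. renewal_count Y (t k) \<omega> = m k"
      proof (intro allI impI)
        fix k assume k: "k \<le> n"
        have "t k < ?S (Suc (m k)) \<omega>"
        proof (cases "m k < m n")
          case True
          then show ?thesis using * k unfolding memC by blast
        next
          case False
          then have "m k = m n" using m[OF k] by simp
          then show ?thesis using * t[OF k] by (metis le_less_trans)
        qed
        then show "renewal_count Y (t k) \<omega> = m k" using count[OF k] * k unfolding memC by blast
      qed
    qed
  qed
  have tS: "0 \<le> t (Suc n)" using t[of n] tn by simp
  have joint: "AE \<omega> in M. (\<forall>k\<le>Suc n. renewal_count Y (t k) \<omega> = m k) \<longleftrightarrow>
      (?U \<omega> \<in> ?C \<and> ?S (m n) \<omega> \<le> t n \<and> t n < ?S (Suc (m n)) \<omega>) \<and>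
      ?S (m n + d) \<omega> \<le> t n + (t (Suc n) - t n) \<and> t n + (t (Suc n) - t n) < ?S (Suc (m n + d)) \<omega>"
    using hist AE_count_eq_iff
  proof eventually_elim
    case (elim \<omega>)
    have last: "renewal_count Y (t (Suc n)) \<omega> = m (Suc n) \<longleftrightarrow>
        ?S (m n + d) \<omega> \<le> t n + (t (Suc n) - t n) \<and> t n + (t (Suc n) - t n) < ?S (Suc (m n + d)) \<omega>"
      using elim(2) tS unfolding d by (simp del: sum.cl_ivl_Suc)
    show ?case by (simp only: all_le_Suc_iff last elim(1))
  qed
  have mU: "?U \<in> M \<rightarrow>\<^sub>M ?PU" by (rule measurable_restrict) simp
  have [measurable]: "Measurable.pred M (\<lambda>\<omega>. ?U \<omega> \<in> ?C)" by (rule pred_sets2[OF C mU])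
  have [measurable]: "?S i \<in> borel_measurable M" for i by (rule borel_measurable_sum) simp
  have mN: "{\<omega>\<in>space M. \<forall>k\<le>i. renewal_count Y (t k) \<omega> = m k} \<in> sets M" if "i \<le> Suc n" for i
  proof -
    have "0 \<le> t k" if "k \<le> i" for k
      using t[of k] tS \<open>k \<le> i\<close> \<open>i \<le> Suc n\<close> by (cases "k = Suc n") auto
    then have "{\<omega>\<in>space M. \<forall>k\<in>{..i}. renewal_count Y (t k) \<omega> = m k} \<in> sets M"
      by (intro sets.sets_Collect_finite_All) auto
    then show ?thesis by (simp only: Ball_def atMost_iff)
  qed
  have "prob {\<omega>\<in>space M. \<forall>k\<le>Suc n. renewal_count Y (t k) \<omega> = m k} =
      prob {\<omega>\<in>space M. (?U \<omega> \<in> ?C \<and> ?S (m n) \<omega> \<le> t n \<and> t n < ?S (Suc (m n)) \<omega>) \<and>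
      ?S (m n + d) \<omega> \<le> t n + (t (Suc n) - t n) \<and> t n + (t (Suc n) - t n) < ?S (Suc (m n + d)) \<omega>}"
    by (rule prob_cong_AE[OF joint mN[OF order_refl]]) measurable
  also have "\<dots> = prob {\<omega>\<in>space M. ?U \<omega> \<in> ?C \<and> ?S (m n) \<omega> \<le> t n \<and> t n < ?S (Suc (m n)) \<omega>} *
      pmf (poisson0_pmf (\<theta> * (t (Suc n) - t n))) d"
    by (rule prob_count_after_history[OF C]) (use tn in simp)
  also have "prob {\<omega>\<in>space M. ?U \<omega> \<in> ?C \<and> ?S (m n) \<omega> \<le> t n \<and> t n < ?S (Suc (m n)) \<omega>} =
      prob {\<omega>\<in>space M. \<forall>k\<le>n. renewal_count Y (t k) \<omega> = m k}"
    by (rule prob_cong_AE[OF hist mN[OF le_SucI[OF order_refl]], symmetric]) measurable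
  finally show ?thesis .
qed

text \<open>Once the indices \<open>m k\<close> are frozen, the walk event concerns
  \<open>chi\<close> alone and the count event \<open>Y\<close> alone.\<close>

lemma prob_count_walk:
  fixes n :: nat
  assumes t: "\<And>k. k \<le> n \<Longrightarrow> 0 \<le> t k"
  shows "prob {\<omega>\<in>space M. (\<forall>k\<le>n. walk (m k) \<omega> = x k) \<and> (\<forall>k\<le>n. renewal_count Y (t k) \<omega> = m k)} =
    prob {\<omega>\<in>space M. \<forall>k\<le>n. walk (m k) \<omega> = x k} *
    prob {\<omega>\<in>space M. \<forall>k\<le>n. renewal_count Y (t k) \<omega> = m k}"
proof -
  let ?P = "\<Pi>\<^sub>M k\<in>{1::nat..}. (borel :: real measure)"
  let ?A = "{c\<in>space ?P. \<forall>k\<in>{..n}. reflected_walk c (m k) = x k}"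
  \<comment> \<open>Coordinate projections in place of \<open>Y\<close> turn the count into a
    function of the gap sequence, as independence of the two sequences requires.\<close>
  let ?B = "{y\<in>space ?P. \<forall>k\<in>{..n}. renewal_count (\<lambda>j y. y j) (t k) y = m k}"
  have A: "?A \<in> sets ?P"
  proof (rule sets.sets_Collect_finite_All)
    fix k
    have [measurable]: "(\<lambda>c. reflected_walk c (m k)) \<in> ?P \<rightarrow>\<^sub>M count_space UNIV"
      by (rule measurable_reflected_walk) simp
    show "{c\<in>space ?P. reflected_walk c (m k) = x k} \<in> sets ?P" by measurable
  qed simp
  have B: "?B \<in> sets ?P"
  proof (rule sets.sets_Collect_finite_All)
    fix k assume "k \<in> {..n}"
    then have [measurable]: "renewal_count (\<lambda>j y. y j) (t k) \<in> ?P \<rightarrow>\<^sub>M count_space UNIV"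
      by (intro measurable_renewal_count measurable_component_singleton t) auto
    show "{y\<in>space ?P. renewal_count (\<lambda>j y. y j) (t k) y = m k} \<in> sets ?P" by measurable
  qed simp
  have sp: "(\<lambda>k\<in>{1..}. f k) \<in> space ?P" for f :: "nat \<Rightarrow> real"
    by (auto simp: space_PiM PiE_def extensional_def)
  have w: "reflected_walk (\<lambda>k\<in>{1..}. chi k \<omega>) i = walk i \<omega>" for i \<omega>
    by (rule reflected_walk_cong) simp
  have "(\<Sum>j=1..i. (\<lambda>k\<in>{1..}. Y k \<omega>) j) = (\<Sum>j=1..i. Y j \<omega>)" for i \<omega>
    by (rule sum.cong) auto
  then have c: "renewal_count (\<lambda>j y. y j) s (\<lambda>k\<in>{1..}. Y k \<omega>) = renewal_count Y s \<omega>" for s \<omega>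
    unfolding renewal_count_def by simp
  show ?thesis
    using prob_indep_var_conj[OF chi_Y_indep A B]
    by (simp only: mem_Collect_eq sp w c simp_thms atMost_iff Ball_def)
qed

text \<open>On each refined history the number of new renewals is Poisson and the walk makes that
  many kernel steps from \<open>x n\<close>. Summing over this number gives the uniformised
  transition probability, the same for all refinements.\<close>

lemma prob_queue_Markov:
  fixes x :: "nat \<Rightarrow> nat"
  assumes t0: "0 \<le> t 0" and t: "\<And>k. k \<le> n \<Longrightarrow> t k < t (Suc k)"
  shows "prob {\<omega>\<in>space M. \<forall>k\<le>Suc n. queue (t k) \<omega> = x k} =
    prob {\<omega>\<in>space M. \<forall>k\<le>n. queue (t k) \<omega> = x k} *
    pmf (uniformized \<theta> (reflected_walk_kernel p) (t (Suc n) - t n) (x n)) (x (Suc n))"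
proof -
  let ?K = "reflected_walk_kernel p" and ?h = "t (Suc n) - t n"
  let ?c = "pmf (uniformized \<theta> ?K ?h (x n)) (x (Suc n))"
  have tmono: "t k \<le> t i" if "k \<le> i" "i \<le> Suc n" for k i
    using that
  proof (induction i rule: dec_induct)
    case (step i)
    then show ?case using t[of i] by simp
  qed simp
  have tnn: "0 \<le> t k" if "k \<le> Suc n" for k using tmono[of 0 k] that t0 by simp
  have mN [measurable]: "renewal_count Y (t k) \<in> M \<rightarrow>\<^sub>M count_space UNIV"
    and mQ [measurable]: "queue (t k) \<in> M \<rightarrow>\<^sub>M count_space UNIV" if "k \<le> Suc n" for k
    using tnn[OF that] by measurable
  have mP: "Measurable.pred M (\<lambda>\<omega>. \<forall>k\<le>n. queue (t k) \<omega> = x k)"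
  proof -
    have "{\<omega>\<in>space M. \<forall>k\<in>{..n}. queue (t k) \<omega> = x k} \<in> sets M"
      by (rule sets.sets_Collect_finite_All) auto
    then show ?thesis by (simp add: pred_def)
  qed
  \<comment> \<open>The counts at the observed times form a list of naturals, a countable type, so
    they can be summed out at the end.\<close>
  define L where "L \<omega> = map (\<lambda>k. renewal_count Y (t k) \<omega>) [0..<Suc n]" for \<omega>
  have L: "L \<omega> = l \<longleftrightarrow> length l = Suc n \<and> (\<forall>k\<le>n. renewal_count Y (t k) \<omega> = l ! k)" for \<omega> l
    unfolding L_def by (auto simp: list_eq_iff_nth_eq less_Suc_eq_le simp del: upt_Suc)
  have mL: "L \<in> M \<rightarrow>\<^sub>M count_space UNIV"
  proof (rule measurable_count_space_eq_countable[THEN iffD2, OF countableI_type], safe)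
    fix l
    have "{\<omega>\<in>space M. \<forall>k\<in>{..n}. renewal_count Y (t k) \<omega> = l ! k} \<in> sets M"
      by (rule sets.sets_Collect_finite_All) auto
    moreover have "L -` {l} \<inter> space M =
        (if length l = Suc n then {\<omega>\<in>space M. \<forall>k\<in>{..n}. renewal_count Y (t k) \<omega> = l ! k} else {})"
    proof -
      have "L -` {l} \<inter> space M = {\<omega>\<in>space M. L \<omega> = l}" by auto
      then show ?thesis unfolding L by auto
    qed
    ultimately show "L -` {l} \<inter> space M \<in> sets M" by simp
  qed auto
  have mPL: "Measurable.pred M (\<lambda>\<omega>. (\<forall>k\<le>n. queue (t k) \<omega> = x k) \<and> L \<omega> = l)" for l
  proof (rule pred_intros_logic(3)[OF mP])
    show "Measurable.pred M (\<lambda>\<omega>. L \<omega> = l)" using mL by measurable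
  qed
  have mPLQ: "Measurable.pred M (\<lambda>\<omega>. ((\<forall>k\<le>n. queue (t k) \<omega> = x k) \<and> L \<omega> = l) \<and> queue (t (Suc n)) \<omega> = x (Suc n))" for l
  proof (rule pred_intros_logic(3)[OF mPL])
    show "Measurable.pred M (\<lambda>\<omega>. queue (t (Suc n)) \<omega> = x (Suc n))" using mQ[of "Suc n"] by measurable
  qed
  have split: "prob {\<omega>\<in>space M. ((\<forall>k\<le>n. queue (t k) \<omega> = x k) \<and> L \<omega> = l) \<and> queue (t (Suc n)) \<omega> = x (Suc n)} =
      prob {\<omega>\<in>space M. (\<forall>k\<le>n. queue (t k) \<omega> = x k) \<and> L \<omega> = l} * ?c" for l
  proof (cases "length l = Suc n \<and> (\<forall>k\<le>n. l ! k \<le> l ! n)")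
    \<comment> \<open>Lists of the wrong length or with an entry above the last one are not
      realised, as counts are monotone almost surely; both sides are then 0.\<close>
    case False
    have "AE \<omega> in M. L \<omega> \<noteq> l"
      using AE_count_mono
    proof eventually_elim
      case (elim \<omega>)
      then have "renewal_count Y (t k) \<omega> \<le> renewal_count Y (t n) \<omega>" if "k \<le> n" for k
        using tmono[of k n] tnn[of k] that by simp
      then have "\<forall>k\<le>n. l ! k \<le> l ! n" "length l = Suc n" if "L \<omega> = l"
        using that[unfolded L] by auto
      then show ?case using False by blast
    qed
    have null: "prob {\<omega>\<in>space M. R \<omega>} = 0" if R: "Measurable.pred M R" "\<And>\<omega>. R \<omega> \<Longrightarrow> L \<omega> = l" for R
    proof (subst prob_Collect_eq_0)
      show "AE \<omega> in M. \<not> R \<omega>" using \<open>AE \<omega> in M. L \<omega> \<noteq> l\<close> R(2) by (auto elim: eventually_mono)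
    qed (use R(1) in \<open>simp add: pred_def\<close>)
    have "prob {\<omega>\<in>space M. (\<forall>k\<le>n. queue (t k) \<omega> = x k) \<and> L \<omega> = l} = 0"
      by (rule null[OF mPL]) simp
    moreover have "prob {\<omega>\<in>space M. ((\<forall>k\<le>n. queue (t k) \<omega> = x k) \<and> L \<omega> = l) \<and> queue (t (Suc n)) \<omega> = x (Suc n)} = 0"
      by (rule null[OF mPLQ]) simp
    ultimately show ?thesis by simp
  next
    case True
    define m where "m k = l ! k" for k
    have le: "m k \<le> m n" if "k \<le> n" for k using True that by (simp add: m_def)
    define a where "a = prob {\<omega>\<in>space M. \<forall>k\<le>n. renewal_count Y (t k) \<omega> = m k}"
    define w where "w = prob {\<omega>\<in>space M. \<forall>k\<le>n. walk (m k) \<omega> = x k}"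
    have PL: "(\<forall>k\<le>n. queue (t k) \<omega> = x k) \<and> L \<omega> = l \<longleftrightarrow>
        (\<forall>k\<le>n. walk (m k) \<omega> = x k) \<and> (\<forall>k\<le>n. renewal_count Y (t k) \<omega> = m k)" for \<omega>
      using True by (auto simp: L queue_def m_def)
    have aw: "prob {\<omega>\<in>space M. (\<forall>k\<le>n. queue (t k) \<omega> = x k) \<and> L \<omega> = l} = w * a"
      unfolding PL a_def w_def by (rule prob_count_walk) (simp add: tnn)
    \<comment> \<open>The number of renewals in the last interval. Truncated subtraction is exact
      almost surely by monotonicity of the count.\<close>
    define J where "J \<omega> = renewal_count Y (t (Suc n)) \<omega> - m n" for \<omega>
    have mJ: "J \<in> M \<rightarrow>\<^sub>M count_space UNIV" unfolding J_def by measurable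
    have J: "prob {\<omega>\<in>space M. (((\<forall>k\<le>n. queue (t k) \<omega> = x k) \<and> L \<omega> = l) \<and> queue (t (Suc n)) \<omega> = x (Suc n)) \<and> J \<omega> = d} =
        w * a * (pmf (poisson0_pmf (\<theta> * ?h)) d * pmf (kernel_power ?K d (x n)) (x (Suc n)))" for d
    proof -
      define m' where "m' = m(Suc n := m n + d)"
      have m': "m' k = m k" if "k \<le> n" for k using that by (simp add: m'_def)
      have m'S: "m' (Suc n) = m' n + d" by (simp add: m'_def)
      have "prob {\<omega>\<in>space M. (((\<forall>k\<le>n. queue (t k) \<omega> = x k) \<and> L \<omega> = l) \<and> queue (t (Suc n)) \<omega> = x (Suc n)) \<and> J \<omega> = d} =
          prob {\<omega>\<in>space M. (\<forall>k\<le>Suc n. walk (m' k) \<omega> = x k) \<and> (\<forall>k\<le>Suc n. renewal_count Y (t k) \<omega> = m' k)}"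
      proof (rule prob_cong_AE)
        show "AE \<omega> in M. (((\<forall>k\<le>n. queue (t k) \<omega> = x k) \<and> L \<omega> = l) \<and> queue (t (Suc n)) \<omega> = x (Suc n)) \<and> J \<omega> = d \<longleftrightarrow>
          (\<forall>k\<le>Suc n. walk (m' k) \<omega> = x k) \<and> (\<forall>k\<le>Suc n. renewal_count Y (t k) \<omega> = m' k)"
          using AE_count_mono
        proof eventually_elim
          case (elim \<omega>)
          then have "renewal_count Y (t n) \<omega> \<le> renewal_count Y (t (Suc n)) \<omega>"
            using tnn[of n] tmono[of n "Suc n"] by simp
          then have "renewal_count Y (t n) \<omega> = m n \<Longrightarrow> J \<omega> = d \<longleftrightarrow> renewal_count Y (t (Suc n)) \<omega> = m' (Suc n)"
            by (auto simp: J_def m'_def)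
          then show ?case
            unfolding PL all_le_Suc_iff by (auto simp: m' queue_def)
        qed
        show "{\<omega>\<in>space M. (((\<forall>k\<le>n. queue (t k) \<omega> = x k) \<and> L \<omega> = l) \<and> queue (t (Suc n)) \<omega> = x (Suc n)) \<and> J \<omega> = d} \<in> sets M"
        proof -
          have "Measurable.pred M (\<lambda>\<omega>. J \<omega> = d)" using mJ by measurable
          from pred_intros_logic(3)[OF mPLQ[of l] this] show ?thesis by (simp only: pred_def)
        qed
        have "{\<omega>\<in>space M. \<forall>k\<in>{..Suc n}. walk (m' k) \<omega> = x k \<and> renewal_count Y (t k) \<omega> = m' k} \<in> sets M"
          by (rule sets.sets_Collect_finite_All) auto
        then show "{\<omega>\<in>space M. (\<forall>k\<le>Suc n. walk (m' k) \<omega> = x k) \<and> (\<forall>k\<le>Suc n. renewal_count Y (t k) \<omega> = m' k)} \<in> sets M"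
          by (simp add: ball_conj_distrib)
      qed
      also have "\<dots> = prob {\<omega>\<in>space M. \<forall>k\<le>Suc n. walk (m' k) \<omega> = x k} *
          prob {\<omega>\<in>space M. \<forall>k\<le>Suc n. renewal_count Y (t k) \<omega> = m' k}"
        by (rule prob_count_walk) (simp add: tnn)
      also have "prob {\<omega>\<in>space M. \<forall>k\<le>Suc n. renewal_count Y (t k) \<omega> = m' k} = a * pmf (poisson0_pmf (\<theta> * ?h)) d"
      proof -
        have "prob {\<omega>\<in>space M. \<forall>k\<le>Suc n. renewal_count Y (t k) \<omega> = m' k} =
            prob {\<omega>\<in>space M. \<forall>k\<le>n. renewal_count Y (t k) \<omega> = m' k} * pmf (poisson0_pmf (\<theta> * ?h)) d"
          by (rule prob_count_Markov) (simp_all add: tnn tmono m' le m'S)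
        then show ?thesis by (simp add: m' a_def cong: conj_cong)
      qed
      also have "prob {\<omega>\<in>space M. \<forall>k\<le>Suc n. walk (m' k) \<omega> = x k} = w * pmf (kernel_power ?K d (x n)) (x (Suc n))"
      proof -
        have "(\<forall>k\<le>Suc n. walk (m' k) \<omega> = x k) \<longleftrightarrow> (\<forall>k\<le>n. walk (m k) \<omega> = x k) \<and> walk (m n + d) \<omega> = x (Suc n)" for \<omega>
          unfolding all_le_Suc_iff using m' m'S by auto
        then show ?thesis unfolding w_def using prob_walk_Markov[where m = m and n = n and x = x and d = d and y = "x (Suc n)", OF le] by simp
      qed
      finally show ?thesis by (simp only: mult_ac)
    qed
    have "(\<lambda>d. w * a * (pmf (poisson0_pmf (\<theta> * ?h)) d * pmf (kernel_power ?K d (x n)) (x (Suc n)))) sums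
        prob {\<omega>\<in>space M. ((\<forall>k\<le>n. queue (t k) \<omega> = x k) \<and> L \<omega> = l) \<and> queue (t (Suc n)) \<omega> = x (Suc n)}"
      using prob_eq_suminf_values[OF mPLQ[of l] mJ] by (simp only: J)
    \<comment> \<open>Mixing the kernel powers over the Poisson law of \<open>d\<close> is the
      definition of \<open>uniformized\<close>.\<close>
    moreover have "(\<lambda>d. w * a * (pmf (poisson0_pmf (\<theta> * ?h)) d * pmf (kernel_power ?K d (x n)) (x (Suc n)))) sums (w * a * ?c)"
      unfolding uniformized_def by (intro sums_mult has_sum_imp_sums pmf_bind_has_sum)
    ultimately show ?thesis unfolding aw by (rule sums_unique2)
  qed
  have "prob {\<omega>\<in>space M. (\<forall>k\<le>n. queue (t k) \<omega> = x k) \<and> queue (t (Suc n)) \<omega> = x (Suc n)} =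
      prob {\<omega>\<in>space M. \<forall>k\<le>n. queue (t k) \<omega> = x k} * ?c"
    by (rule prob_conj_eq_mult_countable[OF mP _ mL split]) (use mQ[of "Suc n"] in measurable)
  then show ?thesis unfolding all_le_Suc_iff .
qed

end

section \<open>From the integer-valued chain to the real-valued queue length\<close>

context renewal_subordinated_walk
begin

lemma AE_good_paths:
  "AE \<omega> in M. (\<forall>k\<ge>1. 0 < Y k \<omega>) \<and> (\<forall>b. \<exists>k. b < (\<Sum>j=1..k. Y j \<omega>)) \<and>
    (\<forall>k\<ge>1. chi k \<omega> = 1 \<or> chi k \<omega> = - 1)"
  using AE_Y_pos AE_Y_sum_unbounded AE_chi by eventually_elim blast

lemma AE_queue_length:
  "AE \<omega> in M. \<forall>t\<ge>0. renewal_ML_queue_length chi Y t \<omega> = real (queue t \<omega>)"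
  using AE_good_paths
proof eventually_elim
  case (elim \<omega>)
  then have "0 \<le> t \<Longrightarrow> renewal_ML_queue_length chi Y t \<omega> = real (queue t \<omega>)" for t
    unfolding queue_def by (intro renewal_ML_queue_length_eq_reflected_walk) (elim conjE, assumption)+
  then show ?case by blast
qed

lemma queue_length_measurable:
  "0 \<le> t \<Longrightarrow> renewal_ML_queue_length chi Y t \<in> borel_measurable M"
  by (rule measurable_renewal_ML_queue_length) simp_all

lemma continuous_time_markov_chain_queue_length:
  defines "g \<equiv> (\<lambda>r::real. nat \<lfloor>r\<rfloor>)"
  assumes q: "\<And>i j. q (real i) (real j) =
    \<theta> * (pmf (reflected_walk_kernel p i) j - (if i = j then 1 else 0))"
  shows "continuous_time_markov_chain M (\<nat> :: real set) q 0 (renewal_ML_queue_length chi Y)"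
proof -
  let ?Q = "renewal_ML_queue_length chi Y" and ?K = "reflected_walk_kernel p"
  have g_real: "g (real i) = i" for i by (simp add: g_def)
  have bij: "bij_betw g \<nat> UNIV"
    by (rule bij_betw_byWitness[where f' = real]) (auto simp: g_real elim!: Nats_cases)
  have eq_iff: "real i = x \<longleftrightarrow> i = g x" if "x \<in> \<nat>" for i x
    using that by (auto simp: g_real elim!: Nats_cases)
  have "transition_semigroup \<nat> (\<lambda>i j. \<theta> * (pmf (?K (g i)) (g j) - (if g i = g j then 1 else 0)))
      (\<lambda>t i j. pmf (uniformized \<theta> ?K t (g i)) (g j))"
    by (rule transition_semigroup_reindex[OF bij transition_semigroup_uniformized]) (use rate_pos in simp)
  \<comment> \<open>Only the entries of \<open>q\<close> on \<open>\<nat>\<close> enter the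
    semigroup conditions, so agreement there is enough.\<close>
  moreover have "\<theta> * (pmf (?K (g i)) (g j) - (if g i = g j then 1 else 0)) = q i j"
    if "i \<in> \<nat>" "j \<in> \<nat>" for i j
    using that q by (auto simp: g_real elim!: Nats_cases)
  ultimately have semigroup: "transition_semigroup \<nat> q (\<lambda>t i j. pmf (uniformized \<theta> ?K t (g i)) (g j))"
    unfolding transition_semigroup_def by simp
  have paths: "AE \<omega> in M. \<forall>t\<ge>0. ?Q t \<omega> \<in> \<nat> \<and> (\<forall>\<^sub>F s in at_right t. ?Q s \<omega> = ?Q t \<omega>)"
    using AE_good_paths AE_queue_length
  proof eventually_elim
    case (elim \<omega>)
    show ?case
    proof (intro allI impI conjI)
      fix t :: real assume t: "0 \<le> t"
      then show "?Q t \<omega> \<in> \<nat>" using elim(2) by simp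
      have "\<forall>\<^sub>F s in at_right t. renewal_count Y s \<omega> = renewal_count Y t \<omega>"
        using elim(1) t by (intro renewal_count_right_constant) (elim conjE, assumption)+
      moreover have "\<forall>\<^sub>F s in at_right t. t < s" by (rule eventually_at_right_less)
      ultimately show "\<forall>\<^sub>F s in at_right t. ?Q s \<omega> = ?Q t \<omega>"
      proof eventually_elim
        case (elim s)
        then have "0 \<le> s" using t by simp
        with elim t \<open>\<forall>t\<ge>0. ?Q t \<omega> = real (queue t \<omega>)\<close> show ?case by (simp add: queue_def)
      qed
    qed
  qed
  have "AE \<omega> in M. ?Q 0 \<omega> = 0"
    using AE_queue_length AE_count_eq_iff AE_Y_pos
  proof eventually_elim
    case (elim \<omega>)
    have "renewal_count Y 0 \<omega> = 0" using elim(2,3) by simp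
    then show ?case using elim(1) by (simp add: queue_def)
  qed
  moreover have "cond_prob M (\<lambda>\<omega>. ?Q (t (Suc n)) \<omega> = x (Suc n)) (\<lambda>\<omega>. \<forall>k\<le>n. ?Q (t k) \<omega> = x k) =
      pmf (uniformized \<theta> ?K (t (Suc n) - t n) (g (x n))) (g (x (Suc n)))"
    if t0: "0 \<le> t 0" and t: "\<forall>k\<le>n. t k < t (Suc k)" and x: "\<forall>k\<le>Suc n. x k \<in> \<nat>"
      and pos: "0 < prob {\<omega>\<in>space M. \<forall>k\<le>n. ?Q (t k) \<omega> = x k}" for n t x
  proof -
    have tnn: "0 \<le> t k" if "k \<le> Suc n" for k
      using that
    proof (induction k)
      case (Suc k)
      then show ?case using t[rule_format, of k] by simp
    qed (rule t0)
    \<comment> \<open>A finite history of the real-valued process has the same probability as its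
      integer version, since the two processes agree at all times off one null set.\<close>
    have transfer: "prob {\<omega>\<in>space M. \<forall>k\<le>i. ?Q (t k) \<omega> = x k} = prob {\<omega>\<in>space M. \<forall>k\<le>i. queue (t k) \<omega> = g (x k)}"
      if i: "i \<le> Suc n" for i
    proof (rule prob_cong_AE)
      show "AE \<omega> in M. (\<forall>k\<le>i. ?Q (t k) \<omega> = x k) \<longleftrightarrow> (\<forall>k\<le>i. queue (t k) \<omega> = g (x k))"
        using AE_queue_length
      proof eventually_elim
        case (elim \<omega>)
        then have "?Q (t k) \<omega> = x k \<longleftrightarrow> queue (t k) \<omega> = g (x k)" if "k \<le> i" for k
          using tnn[of k] x i that by (simp add: eq_iff)
        then show ?case by blast
      qed
      have "{\<omega>\<in>space M. \<forall>k\<in>{..i}. ?Q (t k) \<omega> = x k} \<in> sets M"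
      proof (rule sets.sets_Collect_finite_All)
        fix k assume "k \<in> {..i}"
        then have "?Q (t k) \<in> borel_measurable M" using i by (intro queue_length_measurable tnn) simp
        then show "{\<omega>\<in>space M. ?Q (t k) \<omega> = x k} \<in> sets M" by measurable
      qed simp
      then show "{\<omega>\<in>space M. \<forall>k\<le>i. ?Q (t k) \<omega> = x k} \<in> sets M" by (simp only: Ball_def atMost_iff)
      have "{\<omega>\<in>space M. \<forall>k\<in>{..i}. queue (t k) \<omega> = g (x k)} \<in> sets M"
      proof (rule sets.sets_Collect_finite_All)
        fix k assume "k \<in> {..i}"
        then have "queue (t k) \<in> M \<rightarrow>\<^sub>M count_space UNIV" using i by (intro queue_measurable tnn) simp
        then show "{\<omega>\<in>space M. queue (t k) \<omega> = g (x k)} \<in> sets M" by measurable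
      qed simp
      then show "{\<omega>\<in>space M. \<forall>k\<le>i. queue (t k) \<omega> = g (x k)} \<in> sets M" by (simp only: Ball_def atMost_iff)
    qed
    have "{\<omega>\<in>space M. ?Q (t (Suc n)) \<omega> = x (Suc n) \<and> (\<forall>k\<le>n. ?Q (t k) \<omega> = x k)} =
        {\<omega>\<in>space M. \<forall>k\<le>Suc n. ?Q (t k) \<omega> = x k}"
      by (auto simp: all_le_Suc_iff)
    then have "cond_prob M (\<lambda>\<omega>. ?Q (t (Suc n)) \<omega> = x (Suc n)) (\<lambda>\<omega>. \<forall>k\<le>n. ?Q (t k) \<omega> = x k) =
        prob {\<omega>\<in>space M. \<forall>k\<le>Suc n. ?Q (t k) \<omega> = x k} / prob {\<omega>\<in>space M. \<forall>k\<le>n. ?Q (t k) \<omega> = x k}"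
      by (simp add: cond_prob_def)
    also have "prob {\<omega>\<in>space M. \<forall>k\<le>Suc n. ?Q (t k) \<omega> = x k} =
        prob {\<omega>\<in>space M. \<forall>k\<le>n. ?Q (t k) \<omega> = x k} *
        pmf (uniformized \<theta> ?K (t (Suc n) - t n) (g (x n))) (g (x (Suc n)))"
      using prob_queue_Markov[of t n "\<lambda>k. g (x k)"] t0 t transfer[of "Suc n"] transfer[of n] by simp
    finally show ?thesis using pos by simp
  qed
  moreover have "{\<omega>\<in>space M. ?Q t \<omega> = i} \<in> sets M" if "0 \<le> t" for t i
    using queue_length_measurable[OF that] by measurable
  ultimately show ?thesis
    unfolding continuous_time_markov_chain_def
    using prob_space_axioms semigroup paths
    by (intro conjI exI[of _ "\<lambda>t i j. pmf (uniformized \<theta> ?K t (g i)) (g j)"] allI impI ballI)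
       (simp_all add: Nats_def)
qed

end

section \<open>Parameters of the chain at orders 1\<close>

lemma pmf_reflected_walk_kernel:
  assumes "0 \<le> p" "p \<le> 1"
  shows "pmf (reflected_walk_kernel p i) j =
    (if j = Suc i then p else 0) + (if j = i - 1 then 1 - p else 0)"
  unfolding reflected_walk_kernel_def map_pmf_def using assms
  by (auto simp: pmf_bind indicator_def)

lemma mittag_leffler_1: "mittag_leffler 1 x = exp x"
proof -
  have "Gamma (1 * real k + 1) = fact k" for k
    using Gamma_fact[of k, where 'a = real] by (simp add: add.commute)
  then show ?thesis
    unfolding mittag_leffler_def exp_def by (simp add: divide_inverse mult.commute)
qed

lemma (in prob_space) exponential_distributed_tailI:
  assumes l: "0 < l" and X [measurable]: "X \<in> borel_measurable M"
    and tail: "\<And>t. 0 \<le> t \<Longrightarrow> prob {\<omega>\<in>space M. t < X \<omega>} = exp (- l * t)"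
  shows "distributed M lborel X (exponential_density l)"
  unfolding exponential_distributed_iff[OF l]
proof (intro conjI allI impI)
  fix a :: real assume "0 \<le> a"
  have "prob {\<omega>\<in>space M. X \<omega> \<le> a} = 1 - prob {\<omega>\<in>space M. a < X \<omega>}"
    using prob_neg[of "\<lambda>\<omega>. a < X \<omega>"] by (simp add: not_less)
  then show "prob {\<omega>\<in>space M. X \<omega> \<le> a} = 1 - exp (- a * l)"
    using tail[OF \<open>0 \<le> a\<close>] by (simp add: mult.commute)
qed fact

text \<open>The race of two exponential clocks. Conditioning on \<open>X\<close> integrates its
  density against the tail of \<open>Z\<close>, and the product is \<open>l / (l + m)\<close> times
  the exponential density of rate \<open>l + m\<close>, which has mass 1.\<close>

lemma (in prob_space) prob_exponential_less:
  assumes l: "0 < l" and m: "0 < m"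
    and X: "distributed M lborel X (exponential_density l)"
    and Z: "distributed M lborel Z (exponential_density m)"
    and ind: "indep_var borel X borel Z"
  shows "prob {\<omega>\<in>space M. X \<omega> < Z \<omega>} = l / (l + m)"
proof -
  have [measurable]: "X \<in> borel_measurable M" "Z \<in> borel_measurable M"
    using ind by (auto dest: indep_var_rv1 indep_var_rv2)
  define G where "G x = prob {\<omega>\<in>space M. x < Z \<omega>}" for x
  \<comment> \<open>A tail function is decreasing, so its negative is monotone and hence
    Borel.\<close>
  have [measurable]: "G \<in> borel_measurable borel"
  proof -
    have "mono (\<lambda>x. - G x)"
      unfolding G_def by (auto simp: mono_def intro!: finite_measure_mono)
    then have "(\<lambda>x. - (- G x)) \<in> borel_measurable borel"
      by (intro borel_measurable_uminus borel_measurable_mono)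
    then show ?thesis by simp
  qed
  have A: "{z. fst z < snd z} \<in> sets (borel \<Otimes>\<^sub>M (borel :: real measure))"
  proof -
    have "{z\<in>space (borel \<Otimes>\<^sub>M borel). fst z < (snd z :: real)} \<in> sets (borel \<Otimes>\<^sub>M borel)" by measurable
    then show ?thesis by (simp add: space_pair_measure)
  qed
  have "emeasure M {\<omega>\<in>space M. X \<omega> < Z \<omega>} = (\<integral>\<^sup>+\<omega>. ennreal (G (X \<omega>)) \<partial>M)"
    using emeasure_indep_var_Pair[OF ind A] by (simp add: G_def emeasure_eq_measure)
  also have "\<dots> = (\<integral>\<^sup>+x. ennreal (exponential_density l x) * ennreal (G x) \<partial>lborel)"
    by (rule distributed_nn_integral[OF X, symmetric]) measurable
  also have "\<dots> = (\<integral>\<^sup>+x. ennreal (l / (l + m)) * ennreal (exponential_density (l + m) x) \<partial>lborel)"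
  proof (rule nn_integral_cong)
    fix x :: real
    show "ennreal (exponential_density l x) * ennreal (G x) =
        ennreal (l / (l + m)) * ennreal (exponential_density (l + m) x)"
    proof (cases "0 \<le> x")
      case True
      then have "G x = exp (- x * m)"
        using exponential_distributedD_gt[OF Z True m] by (simp add: G_def)
      moreover have "exponential_density l x * exp (- x * m) = l / (l + m) * exponential_density (l + m) x"
      proof -
        have "exp (- x * l) * exp (- x * m) = exp (- x * (l + m))"
          by (simp add: exp_add[symmetric] algebra_simps)
        moreover have "l + m \<noteq> 0" using l m by simp
        ultimately show ?thesis using True by (simp add: exponential_density_def mult.assoc)
      qed
      ultimately show ?thesis using l m by (simp add: ennreal_mult'[symmetric] exponential_density_nonneg)
    qed (simp add: exponential_density_def)
  qed
  also have "\<dots> = ennreal (l / (l + m)) * (\<integral>\<^sup>+x. ennreal (exponential_density (l + m) x) \<partial>lborel)"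
    by (rule nn_integral_cmult) measurable
  also have "(\<integral>\<^sup>+x. ennreal (exponential_density (l + m) x) \<partial>lborel) = 1"
    using prob_space.emeasure_space_1[OF prob_space_exponential_density[of "l + m"]] l m
    by (simp add: emeasure_density)
  finally show ?thesis using l m by (simp add: emeasure_eq_measure)
qed

theorem corollary2p6:
  fixes M :: "'a measure" and N :: "'b measure"
    and \<alpha> \<beta> lam mu :: real
    and X1 X2 :: "'b \<Rightarrow> real"
    and chi Y :: "nat \<Rightarrow> 'a \<Rightarrow> real"
  assumes "0 < lam" "0 < mu"
    and "renewal_ML_queue M N \<alpha> \<beta> lam mu X1 X2 chi Y"
    and "\<alpha> = 1" "\<beta> = 1"
  shows "MM1_queue_length_process M lam mu (renewal_ML_queue_length chi Y)"
proof -
  interpret renewal_ML_queue M N \<alpha> \<beta> lam mu X1 X2 chi Y by fact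
  let ?p = "lam / (lam + mu)"
  have exponential: "distributed N lborel X (exponential_density l)"
    if "0 < l" "mittag_leffler_distributed N 1 l X" for l X
    using that unfolding mittag_leffler_distributed_def
    by (intro N.exponential_distributed_tailI) (simp_all add: mittag_leffler_1)
  have p: "N.prob {\<omega>\<in>space N. X1 \<omega> < X2 \<omega>} = ?p"
    using X1_law X2_law rates unfolding \<open>\<alpha> = 1\<close> \<open>\<beta> = 1\<close>
    by (intro N.prob_exponential_less exponential X1_X2_indep)
  interpret renewal_subordinated_walk M Y chi "lam + mu" ?p
  proof
    show "0 < lam + mu" using rates by simp
    fix k :: nat assume k: "1 \<le> k"
    show "distributed M lborel (Y k) (exponential_density (lam + mu))"
    proof (rule M.exponential_distributed_tailI)
      show "Y k \<in> borel_measurable M" using Y_indep k by (auto simp: M.indep_vars_def)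
      show "M.prob {\<omega>\<in>space M. t < Y k \<omega>} = exp (- (lam + mu) * t)" if "0 \<le> t" for t
        using Y_tail[OF k that] that unfolding \<open>\<alpha> = 1\<close> \<open>\<beta> = 1\<close>
        by (simp add: mittag_leffler_1 exp_add[symmetric] algebra_simps)
    qed (use rates in simp)
    show "M.prob {\<omega>\<in>space M. chi k \<omega> = 1} = ?p" using chi_up[OF k] p by simp
    show "M.prob {\<omega>\<in>space M. chi k \<omega> = - 1} = 1 - ?p" using chi_down[OF k] p by simp
  qed (fact Y_indep chi_indep chi_Y_indep)+
  \<comment> \<open>A generic \<open>p\<close> with \<open>(lam + mu) * p = lam\<close> avoids
    fractions. At \<open>i = 0\<close> the self-loop of mass \<open>1 - p\<close> reduces the
    diagonal to \<open>- lam\<close>; elsewhere there is no self-loop and it is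
    \<open>- (lam + mu)\<close>.\<close>
  have rate: "MM1_rate lam mu (real i) (real j) =
      (lam + mu) * (pmf (reflected_walk_kernel p i) j - (if i = j then 1 else 0))"
    if "0 \<le> p" "p \<le> 1" "(lam + mu) * p = lam" for i j p
    using that unfolding MM1_rate_def
    by (cases i) (auto simp: pmf_reflected_walk_kernel algebra_simps)
  have "MM1_rate lam mu (real i) (real j) =
      (lam + mu) * (pmf (reflected_walk_kernel ?p i) j - (if i = j then 1 else 0))" for i j
    by (rule rate) (use rates in simp_all)
  then show ?thesis
    unfolding MM1_queue_length_process_def by (rule continuous_time_markov_chain_queue_length)
qed

end
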